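(* Let $C$ be a closed convex cone in $\mathbb{R}^n$ with non-empty interior and not containing an entire line. Let $K_1,K_2$ be $C$-coconvex bodies and let $\lambda\in(0,1)$. Then $$V_n\big((1-\lambda)K_1\oplus\lambda K_2\big)^{1/n}\leq(1-\lambda)V_n(K_1)^{1/n}+\lambda V_n(K_2)^{1/n},$$ and equality holds if and only if $K_1=\alpha K_2$ for some $\alpha>0$.
   Context: Let $C\subset\mathbb{R}^n$ be a closed convex cone with non-empty interior, not containing an entire line. A $C$-coconvex body is a non-empty closed bounded proper subset $K$ of $C$ such that $C\setminus K$ is convex. For $t>0$, $tK=\{tx: x\in K\}$. For $C$-coconvex bodies $K_1,K_2$, the operation $\oplus$ is defined by $K_1\oplus K_2=C\setminus\big((C\setminus K_1)+(C\setminus K_2)\big)$, where $+$ is the Minkowski sum of sets, $A+B=\{a+b: a\in A,\ b\in B\}$. The set of $C$-coconvex bodies is stable under multiplication by positive scalars and under $\oplus$. $V_n$ denotes the volume (Lebesgue measure) in $\mathbb{R}^n$.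
   Formalization: The implication from equality to K_1=αK_2 is proved only when K_1 and K_2 are closures of their interiors; without this it is false (e.g. K_1={0} gives equality for every K_2). The inequality and the implication from K_1=αK_2 to equality hold for all bodies. *)

theory Defs
  imports "HOL-Analysis.Analysis"
begin

definition contains_line :: "'a::real_vector set \<Rightarrow> bool" where
  "contains_line S \<longleftrightarrow> (\<exists>p v. v \<noteq> 0 \<and> (\<forall>t::real. p + t *\<^sub>R v \<in> S))"

definition pointed_solid_cone :: "'a::real_normed_vector set \<Rightarrow> bool" where
  "pointed_solid_cone C \<longleftrightarrow>
     convex_cone C \<and> closed C \<and> interior C \<noteq> {} \<and> \<not> contains_line C"

definition coconvex_body :: "'a::real_normed_vector set \<Rightarrow> 'a set \<Rightarrow> bool" where
  "coconvex_body C K \<longleftrightarrow>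
     K \<noteq> {} \<and> closed K \<and> bounded K \<and> K \<subset> C \<and> convex (C - K)"

abbreviation dilate :: "real \<Rightarrow> 'a::real_vector set \<Rightarrow> 'a set" where
  "dilate t K \<equiv> (\<lambda>x. t *\<^sub>R x) ` K"

text \<open>The inner \<open>+\<close> is the Minkowski sum of \<^theory>\<open>HOL-Library.Set_Algebras\<close>.\<close>

definition coconvex_sum :: "'a::real_vector set \<Rightarrow> 'a set \<Rightarrow> 'a set \<Rightarrow> 'a set" where
  "coconvex_sum C K L = C - ((C - K) + (C - L))"

text \<open>A coconvex body may have empty interior, and may carry lower-dimensional pieces in the
  boundary of the cone: in the quadrant of the plane, the triangle \<open>x + y \<le> 1\<close> together with the
  segment from \<open>(1, 0)\<close> to \<open>(2, 0)\<close> is coconvex. Volume does not see such pieces, so it can only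
  determine those bodies that are the closure of their interior.\<close>

definition regular_closed :: "'a::topological_space set \<Rightarrow> bool" where
  "regular_closed K \<longleftrightarrow> closure (interior K) = K"

end

theory Submission
  imports Defs
begin

text \<open>
  Scaling reduces the inequality to the case where both bodies have the same volume. Cut the cone
  by a half-space \<open>w \<bullet> x \<le> z\<close> containing both bodies. The truncated complements then have equal
  volumes too, and their convex combination lies in the truncated complement of the coconvex sum, so
  the Brunn--Minkowski inequality for bounded convex sets bounds the volume of the coconvex sum from
  above.

  If equality holds, the equality case of Brunn--Minkowski says that for every direction \<open>u\<close> the
  volumes below the level \<open>u \<bullet> x = s\<close> agree up to a shift of \<open>s\<close>. Taking for \<open>u\<close> the truncating
  functional itself, the two truncated complements have the same top, so the shift is zero. These
  volumes, for all \<open>u\<close> in the interior of the dual cone, determine the complements up to closure.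

  Brunn--Minkowski is proved in its multiplicative form by induction on the dimension through
  slices. The one-dimensional step transports one slice-volume function to the other; in the
  equality case the transport map is a translation, which gives the shift above.
\<close>

section \<open>One-dimensional transport\<close>

text \<open>The complements \<open>C - K\<close> are unbounded, so volumes can be compared only
  after truncation. A truncated complement depends on the body only through the volume removed, so
  equal bodies give convex sets of equal measure, for which the weighted geometric mean loses
  nothing. For this reason the reduction to equal volumes comes with a changed weight. Bodies of
  volume zero cannot be rescaled and need an argument of their own. The equality case of
  Brunn--Minkowski is used in a weak form: not that the two sets are translates, only that their
  sublevel volumes agree up to a shift, for one direction at a time. The shift may depend on the
  direction, so each direction gets its own truncation. Only functionals in the interior of the dual
  cone make that truncation bounded, whereas a hyperplane separating a point from
  \<open>C - K\<close> yields just some member of the dual cone; a small perturbation closes this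
  gap.\<close>

lemma weighted_am_gm_ratio:
  fixes r l :: real
  assumes "0 < r" "0 < l" "l < 1"
  shows "r powr l \<le> (1 - l) + l * r" and "r powr l = (1 - l) + l * r \<Longrightarrow> r = 1"
proof -
  define q where "q = (1 - l) + l * r"
  have q: "0 < q" using assms unfolding q_def by (simp add: add_pos_pos)
  have a1: "ln (r / q) \<le> r / q - 1" using assms q by (intro ln_le_minus_one) auto
  have a2: "ln (1 / q) \<le> 1 / q - 1" using q by (intro ln_le_minus_one) auto
  \<comment> \<open>The tangent bounds \<open>ln x \<le> x - 1\<close> at \<open>r / q\<close> and
    \<open>1 / q\<close>, weighted by \<open>l\<close> and \<open>1 - l\<close>, have right sides
    that cancel because \<open>q\<close> is the weighted mean of \<open>r\<close> and
    \<open>1\<close>. Equality makes both bounds tight, which happens only at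
    \<open>1\<close>.\<close>
  have s: "l * (r / q - 1) + (1 - l) * (1 / q - 1) = 0"
    using q by (simp add: field_simps) (simp add: q_def algebra_simps)
  have e: "l * ln (r / q) + (1 - l) * ln (1 / q) = l * ln r - ln q"
    using assms q by (simp add: ln_div algebra_simps)
  have b: "l * ln (r / q) \<le> l * (r / q - 1)" "(1 - l) * ln (1 / q) \<le> (1 - l) * (1 / q - 1)"
    using a1 a2 assms by (auto intro!: mult_left_mono)
  have le: "l * ln r \<le> ln q" using b s e by linarith
  have p: "r powr l = exp (l * ln r)" using assms by (simp add: powr_def)
  show "r powr l \<le> (1 - l) + l * r"
    unfolding p q_def[symmetric] using le q by (metis exp_le_cancel_iff exp_ln)
  assume "r powr l = (1 - l) + l * r"
  then have "exp (l * ln r) = q" using p q_def by simp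
  then have "l * ln r = ln q" by (metis ln_exp)
  then have "(1 - l) * ln (1 / q) = (1 - l) * (1 / q - 1)" "l * ln (r / q) = l * (r / q - 1)"
    using b s e by linarith+
  then have "ln (1 / q) = 1 / q - 1" "ln (r / q) = r / q - 1" using assms by auto
  then have "1 / q = 1" "r / q = 1" using q assms ln_eq_minus_one[of "1 / q"] ln_eq_minus_one[of "r / q"]
    by (simp_all add: divide_pos_pos del: div_by_1 divide_eq_1_iff)
  then show "r = 1" using q by simp
qed

text \<open>Everything is restricted to the interior \<open>J\<close> of the positivity interval:
  there \<open>f\<close> is continuous and the fundamental theorem of calculus applies, while the
  values at the endpoints are uncontrolled but carry no mass. Together the facts make
  \<open>F\<close> a strictly increasing bijection from \<open>J\<close> onto the open unit
  interval, so that it can be inverted.\<close>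

lemma cumulative_distribution:
  fixes f :: "real \<Rightarrow> real" and R :: real
  defines "J \<equiv> interior {x. 0 < f x}" and "F \<equiv> \<lambda>s. integral {..s} f"
  assumes f0: "\<And>x. 0 \<le> f x" and supp: "\<forall>x. R < \<bar>x\<bar> \<longrightarrow> f x = 0"
    and int: "f integrable_on UNIV" and F1: "integral UNIV f = 1"
    and conv: "convex {x. 0 < f x}" and cont: "continuous_on J f"
  shows "mono F" and "0 \<le> F s" and "F s \<le> 1"
    and "x \<in> J \<Longrightarrow> (F has_real_derivative f x) (at x)"
    and "0 < t \<Longrightarrow> t < 1 \<Longrightarrow> \<exists>x\<in>J. F x = t"
    and "x \<in> J \<Longrightarrow> y \<in> J \<Longrightarrow> x < y \<Longrightarrow> F x < F y"
    and "x \<in> J \<Longrightarrow> 0 < F x \<and> F x < 1"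
    and "(f has_integral 1) J"
proof -
  have intS: "f integrable_on S" if "S \<in> sets lebesgue" for S
  proof -
    have "f absolutely_integrable_on UNIV" using int f0
      by (intro nonnegative_absolutely_integrable_1) auto
    then have "f absolutely_integrable_on S"
      by (rule set_integrable_subset) (use that in auto)
    then show ?thesis by (simp add: absolutely_integrable_on_def)
  qed
  have intle: "f integrable_on {..s}" for s by (rule intS) auto
  have intab: "f integrable_on {a..b}" for a b by (rule intS) auto
  have m: "F x \<le> F y" if "x \<le> y" for x y
    unfolding F_def using that f0 by (intro integral_subset_le intle) auto
  then show mono: "mono F" by (auto simp: mono_def)
  show ge0: "0 \<le> F s" for s unfolding F_def using f0 by (intro integral_nonneg intle) auto
  have "F s \<le> integral UNIV f" for s unfolding F_def
    using f0 by (intro integral_subset_le intle int) auto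
  then show le1: "F s \<le> 1" for s using F1 by simp
  have Fdiff: "F y = F x + integral {x..y} f" if "x \<le> y" for x y
  proof -
    have "integral ({..x} \<union> {x..y}) f = integral {..x} f + integral {x..y} f"
      by (rule integral_Un[OF intle intab]) (rule negligible_subset[of "{x}"], auto)
    moreover have "{..x} \<union> {x..y} = {..y}" using that by auto
    ultimately show ?thesis unfolding F_def by simp
  qed
  have negl: "negligible ({x. 0 < f x} - J)"
    by (rule negligible_subset[OF negligible_convex_frontier[OF conv]])
      (auto simp: J_def frontier_def intro: subsetD[OF closure_subset])
  have J0: "f x = 0 \<or> x \<in> {x. 0 < f x} - J" if "x \<notin> J" for x
    using that f0[of x] by auto
  have JS: "J \<subseteq> {x. 0 < f x}" unfolding J_def by (rule interior_subset)
  have opJ: "open J" unfolding J_def by simp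
  have cJ: "convex J" unfolding J_def using conv by (rule convex_interior)
  show hi: "(f has_integral 1) J"
  proof -
    have "(f has_integral 1) UNIV" using int F1 by (simp add: has_integral_iff)
    then have "((\<lambda>x. if x \<in> J then f x else 0) has_integral 1) UNIV"
      by (rule has_integral_spike[OF negl, rotated]) (use J0 in auto)
    then show ?thesis by (simp add: has_integral_restrict_UNIV)
  qed
  have zero: "integral S f = 0" if "S \<inter> J = {}" for S
  proof (rule integral_unique[OF has_integral_spike[OF negl _ has_integral_0]])
    show "f x = 0" if "x \<in> S - ({x. 0 < f x} - J)" for x
      using J0[of x] that \<open>S \<inter> J = {}\<close> by auto
  qed
  show der: "(F has_real_derivative f x) (at x)" if x: "x \<in> J" for x
  proof -
    obtain e where e: "0 < e" "cball x e \<subseteq> J" using opJ x by (auto simp: open_contains_cball)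
    have sub: "{x - e..x + e} \<subseteq> J" using e by (auto simp: cball_eq_atLeastAtMost)
    have "((\<lambda>u. integral {x-e..u} f) has_real_derivative f x) (at x within {x-e..x+e})"
      by (rule integral_has_real_derivative) (use e sub in \<open>auto intro: continuous_on_subset[OF cont]\<close>)
    from DERIV_add[OF DERIV_const[of "F (x-e)"] this]
    have "((\<lambda>u. F (x-e) + integral {x-e..u} f) has_real_derivative f x) (at x within {x-e..x+e})"
      by simp
    then have "(F has_real_derivative f x) (at x within {x-e..x+e})"
      by (rule has_field_derivative_transform_within[where d=1]) (use e in \<open>auto intro: Fdiff[symmetric]\<close>)
    moreover have "at x within {x-e..x+e} = at x" 
      by (rule at_within_interior) (use e in auto)
    ultimately show ?thesis by simp
  qed
  show sm: "F x < F y" if "x \<in> J" "y \<in> J" "x < y" for x y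
  proof (rule DERIV_pos_imp_increasing[OF that(3)])
    fix z assume "x \<le> z" "z \<le> y"
    then have "z \<in> closed_segment x y" by (auto simp: closed_segment_eq_real_ivl)
    then have "z \<in> J" using cJ that convex_contains_segment by blast
    then show "\<exists>y. DERIV F z :> y \<and> 0 < y" using der JS by blast
  qed
  have nbr: "\<exists>y z. y \<in> J \<and> z \<in> J \<and> y < x \<and> x < z" if x: "x \<in> J" for x
  proof -
    obtain e where e: "0 < e" "cball x e \<subseteq> J" using opJ x by (auto simp: open_contains_cball)
    then have "x - e \<in> J" "x + e \<in> J" by (auto simp: subset_iff dist_norm)
    then show ?thesis using e by (intro exI[of _ "x-e"] exI[of _ "x+e"]) auto
  qed
  show "0 < F x \<and> F x < 1" if "x \<in> J" for x
    using nbr[OF that] sm that ge0 le1 by (meson order_le_less_trans order_less_le_trans)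
  show "\<exists>x\<in>J. F x = t" if t: "0 < t" "t < 1" for t
  proof -
    \<comment> \<open>The absolute value keeps \<open>- b < b\<close> even for negative
      \<open>R\<close>, and the margin \<open>1\<close> puts both points strictly outside the
      support.\<close>
    define b where "b = \<bar>R\<bar> + 1"
    have Fa: "F (-b) = 0" unfolding F_def
      by (rule integral_unique[OF has_integral_is_0]) (use supp in \<open>auto simp: b_def\<close>)
    have "integral UNIV f = integral {..b} f"
    proof -
      have "(f has_integral integral {..b} f) {..b}" using intle by (simp add: has_integral_iff)
      then have "(f has_integral integral {..b} f) UNIV"
        by (rule has_integral_on_superset) (use supp in \<open>auto simp: b_def\<close>)
      then show ?thesis by (rule integral_unique)
    qed
    then have Fb: "F b = 1" unfolding F_def using F1 by simp
    have "continuous_on {-b..b} (\<lambda>u. F (-b) + integral {-b..u} f)"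
      by (intro continuous_intros indefinite_integral_continuous_1 intab)
    then have "continuous_on {-b..b} F"
      by (rule continuous_on_eq) (auto intro: Fdiff[symmetric])
    then obtain x where x: "F x = t"
      using IVT'[of F "-b" t b] Fa Fb t by (auto simp: b_def)
    have "x \<in> J"
    proof (rule ccontr)
      \<comment> \<open>\<open>J\<close> is an interval, so a point outside it has all of
        \<open>J\<close> on one side. One of the two half-lines at \<open>x\<close> then carries no
        mass, and \<open>F x\<close> is \<open>0\<close> or \<open>1\<close>.\<close>
      assume n: "x \<notin> J"
      consider "{..x} \<inter> J = {}" | "{x..} \<inter> J = {}"
      proof -
        have False if "u \<le> x" "u \<in> J" "x \<le> v" "v \<in> J" for u v
        proof -
          have "x \<in> closed_segment u v" using that by (auto simp: closed_segment_eq_real_ivl)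
          then show False using n cJ that convex_contains_segment by blast
        qed
        then show ?thesis using that by (metis Int_iff all_not_in_conv atLeast_iff atMost_iff)
      qed
      then show False
      proof cases
        case 1 then show False using zero[of "{..x}"] x t F_def by auto
      next
        case 2
        have "integral ({..x} \<union> {x..}) f = integral {..x} f + integral {x..} f"
          by (rule integral_Un[OF intle intS]) (auto intro: negligible_subset[of "{x}", OF negligible_sing])
        moreover have "{..x} \<union> {x..} = UNIV" by auto
        ultimately show False using zero[OF 2] x t F1 F_def by auto
      qed
    qed
    then show ?thesis using x by auto
  qed
qed

text \<open>The substitution \<open>S s = (1 - l) * s + l * T s\<close>, where \<open>T\<close>
  carries the mass of \<open>f\<close> to that of \<open>g\<close>, turns the integral of
  \<open>h\<close> over the image of \<open>J\<close> into the integral of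
  \<open>k s = D s * h (S s)\<close>. The hypothesis and the weighted mean inequality give
  \<open>f \<le> k\<close> pointwise. Equal integrals force \<open>f s = g (T s)\<close>, so
  \<open>T\<close> has slope one.\<close>

lemma prekopa_leindler_real:
  fixes f g h :: "real \<Rightarrow> real" and R l :: real
  assumes l: "0 < l" "l < 1"
    and f0: "\<And>x. 0 \<le> f x" and g0: "\<And>x. 0 \<le> g x" and h0: "\<And>x. 0 \<le> h x"
    and fR: "\<forall>x. R < \<bar>x\<bar> \<longrightarrow> f x = 0" and gR: "\<forall>x. R < \<bar>x\<bar> \<longrightarrow> g x = 0"
    and fi: "f integrable_on UNIV" and gi: "g integrable_on UNIV" and hi: "h integrable_on UNIV"
    and f1: "integral UNIV f = 1" and g1: "integral UNIV g = 1"
    and fc: "convex {x. 0 < f x}" and gc: "convex {x. 0 < g x}"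
    and fcont: "continuous_on (interior {x. 0 < f x}) f"
    and gcont: "continuous_on (interior {x. 0 < g x}) g"
    and pl: "\<And>s t. 0 < f s \<Longrightarrow> 0 < g t \<Longrightarrow> f s powr (1 - l) * g t powr l \<le> h ((1 - l) * s + l * t)"
  shows "1 \<le> integral UNIV h"
    and "integral UNIV h = 1 \<Longrightarrow> \<exists>c. \<forall>s. integral {..s} f = integral {..s + c} g"
proof -
  define J where "J = interior {x. 0 < f x}"
  define L where "L = interior {x. 0 < g x}"
  define F where "F s = integral {..s} f" for s
  define G where "G s = integral {..s} g" for s
  note cF = cumulative_distribution[where f=f and R=R, OF f0 fR fi f1 fc fcont, folded J_def F_def]
  note cG = cumulative_distribution[where f=g and R=R, OF g0 gR gi g1 gc gcont, folded L_def G_def]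
  have fpos: "0 < f x" if "x \<in> J" for x using that interior_subset J_def by blast
  have gpos: "0 < g x" if "x \<in> L" for x using that interior_subset L_def by blast
  have injG: "inj_on G L"
    using cG(6) by (auto simp: inj_on_def) (metis less_irrefl linorder_neqE)
  \<comment> \<open>Monotone transport: below \<open>T s\<close> the function \<open>g\<close> has
    as much mass as \<open>f\<close> has below \<open>s\<close>.\<close>
  define T where "T = (\<lambda>s. inv_into L G (F s))"
  have T: "T s \<in> L" "G (T s) = F s" if "s \<in> J" for s
  proof -
    have "F s \<in> G ` L" using cF(7)[OF that] cG(5)[of "F s"] by (metis imageI)
    then show "T s \<in> L" "G (T s) = F s"
      unfolding T_def by (auto intro: inv_into_into f_inv_into_f)
  qed
  have contG: "continuous_on L G"
    by (intro continuous_at_imp_continuous_on ballI DERIV_isCont[OF cG(4)])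
  have derT: "(T has_real_derivative f s / g (T s)) (at s)" if s: "s \<in> J" for s
  proof -
    have "(inv_into L G has_derivative (*) (1 / g (T s))) (at (G (T s)))"
    proof (rule has_derivative_inverse_strong[OF _ T(1)[OF s] contG])
      show "open L" by (simp add: L_def)
      show "inv_into L G (G x) = x" if "x \<in> L" for x using injG that by simp
      show "(G has_derivative (*) (g (T s))) (at (T s))"
        using cG(4)[OF T(1)[OF s]] by (simp add: has_field_derivative_def)
      show "(*) (g (T s)) \<circ> (*) (1 / g (T s)) = id"
        using gpos[OF T(1)[OF s]] by (auto simp: fun_eq_iff)
    qed
    then have "(inv_into L G has_real_derivative (1 / g (T s))) (at (F s))"
      using T(2)[OF s] by (simp add: has_field_derivative_def)
    from DERIV_chain2[OF this cF(4)[OF s]] show ?thesis unfolding T_def by simp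
  qed
  define S where "S = (\<lambda>s. (1 - l) * s + l * T s)"
  define D where "D = (\<lambda>s. (1 - l) + l * (f s / g (T s)))"
  have derS: "(S has_real_derivative D s) (at s)" if "s \<in> J" for s
    unfolding S_def D_def by (auto intro!: derivative_eq_intros derT that)
  have Dpos: "0 < D s" if "s \<in> J" for s
    unfolding D_def using l fpos[OF that] gpos[OF T(1)[OF that]] by (simp add: add_pos_pos)
  have opJ: "open J" and cJ: "convex J" unfolding J_def using fc by (auto intro: convex_interior)
  have inJ: "z \<in> J" if "x \<in> J" "y \<in> J" "x \<le> z" "z \<le> y" for x y z
  proof -
    have "z \<in> closed_segment x y" using that by (auto simp: closed_segment_eq_real_ivl)
    then show ?thesis using cJ that convex_contains_segment by blast
  qed
  have Sm: "S x < S y" if "x \<in> J" "y \<in> J" "x < y" for x y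
    by (rule DERIV_pos_imp_increasing[OF that(3)]) (use inJ that derS Dpos in blast)
  then have injS: "inj_on S J" by (auto simp: inj_on_def) (metis less_irrefl linorder_neqE)
  have contS: "continuous_on J S"
    by (intro continuous_at_imp_continuous_on ballI DERIV_isCont[OF derS])
  have Jl: "J \<in> sets lebesgue" using opJ by auto
  have SJ: "S ` J \<in> sets lebesgue"
  proof -
    have "open (S ` J)" using contS opJ injS by (rule invariance_of_domain)
    then show ?thesis by auto
  qed
  have h_abs: "h absolutely_integrable_on UNIV" using hi h0
    by (intro nonnegative_absolutely_integrable_1) auto
  then have hS: "h absolutely_integrable_on (S ` J)"
    by (rule set_integrable_subset) (use SJ in auto)
  have cv: "(\<lambda>s. \<bar>D s\<bar> * h (S s)) absolutely_integrable_on J \<and>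
      integral J (\<lambda>s. \<bar>D s\<bar> * h (S s)) = integral (S ` J) h"
    using has_absolute_integral_change_of_variables_1'[OF Jl _ injS, of D h "integral (S ` J) h"]
      derS hS by (auto intro: has_field_derivative_at_within)
  define k where "k = (\<lambda>s. D s * h (S s))"
  have kc: "\<bar>D s\<bar> * h (S s) = k s" if "s \<in> J" for s using Dpos[OF that] by (simp add: k_def)
  have ki: "k integrable_on J" and kI: "integral J k = integral (S ` J) h"
    using cv kc unfolding absolutely_integrable_on_def
    by (auto cong: integral_cong integrable_cong)
  have kle: "integral J k \<le> integral UNIV h"
    unfolding kI using hS hi h0 by (intro integral_subset_le) (auto simp: absolutely_integrable_on_def)
  have key: "f s \<le> k s" "k s = f s \<Longrightarrow> f s = g (T s)" if s: "s \<in> J" for s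
  proof -
    define r where "r = f s / g (T s)"
    have fp: "0 < f s" and gp: "0 < g (T s)" using fpos[OF s] gpos[OF T(1)[OF s]] by auto
    have r: "0 < r" using fp gp by (simp add: r_def)
    \<comment> \<open>Splits \<open>f s\<close> into the geometric mean bounded by \<open>h\<close>
      and the factor \<open>r powr l\<close>, which is then compared with the slope
      \<open>D s\<close> of \<open>S\<close>.\<close>
    have e: "f s powr (1 - l) * g (T s) powr l * r powr l = f s"
      using fp gp unfolding r_def
      by (simp add: powr_divide powr_diff)
    have m: "0 < f s powr (1 - l) * g (T s) powr l" using fp gp by simp
    have a: "r powr l \<le> D s" using weighted_am_gm_ratio(1)[OF r l] by (simp add: D_def r_def)
    have b: "f s powr (1 - l) * g (T s) powr l \<le> h (S s)" unfolding S_def by (rule pl[OF fp gp])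
    have c1: "f s \<le> f s powr (1 - l) * g (T s) powr l * D s"
      using mult_left_mono[OF a less_imp_le[OF m]] e by simp
    have c2: "f s powr (1 - l) * g (T s) powr l * D s \<le> k s"
      unfolding k_def using mult_right_mono[OF b less_imp_le[OF Dpos[OF s]]] by (simp add: mult.commute)
    show "f s \<le> k s" using c1 c2 by simp
    assume "k s = f s"
    then have "f s powr (1 - l) * g (T s) powr l * D s = f s powr (1 - l) * g (T s) powr l * r powr l"
      using c1 c2 e by simp
    then have "r powr l = D s" using fp gp by simp
    then have "r = 1" using weighted_am_gm_ratio(2)[OF r l] by (simp add: D_def r_def)
    then show "f s = g (T s)" using gp by (simp add: r_def)
  qed
  have fJ: "f integrable_on J" "integral J f = 1" using cF(8) by (auto simp: has_integral_iff)
  have "integral J f \<le> integral J k" using key(1) fJ ki by (intro integral_le)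
  then show "1 \<le> integral UNIV h" using fJ kle by simp
  assume h1: "integral UNIV h = 1"
  have "((\<lambda>s. k s - f s) has_integral (integral J k - 1)) J"
    using ki fJ by (intro has_integral_diff) (auto simp: has_integral_iff)
  \<comment> \<open>The integral of \<open>k\<close> is squeezed between those of \<open>f\<close>
    and \<open>h\<close>, both equal to \<open>1\<close>.\<close>
  moreover have "integral J k - 1 = 0" using \<open>integral J f \<le> integral J k\<close> fJ kle h1 by simp
  ultimately have k0: "((\<lambda>s. k s - f s) has_integral 0) J" by simp
  then have ka: "(\<lambda>s. k s - f s) absolutely_integrable_on J"
    using key(1) by (intro nonnegative_absolutely_integrable_1) (auto simp: has_integral_iff)
  then have "integral\<^sup>L lebesgue (\<lambda>s. indicator J s *\<^sub>R (k s - f s)) = 0"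
    using set_lebesgue_integral_eq_integral(2)[OF ka] k0
    by (simp add: has_integral_iff set_lebesgue_integral_def)
  then have "AE s in lebesgue. indicator J s *\<^sub>R (k s - f s) = 0"
    using ka key(1) unfolding set_integrable_def
    by (subst integral_nonneg_eq_0_iff_AE[symmetric]) (auto simp: indicator_def)
  then obtain N where N: "N \<in> null_sets lebesgue"
      "{s \<in> space lebesgue. indicator J s *\<^sub>R (k s - f s) \<noteq> 0} \<subseteq> N"
    unfolding eventually_ae_filter by blast
  have "negligible {s \<in> J. k s - f s \<noteq> 0}"
  proof (rule negligible_subset)
    show "negligible N" using N(1) by (simp add: negligible_iff_null_sets)
    show "{s \<in> J. k s - f s \<noteq> 0} \<subseteq> N" using N(2) by (auto simp: subset_iff)
  qed
  then have neg: "negligible {s \<in> J. f s - g (T s) \<noteq> 0}"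
    by (rule negligible_subset) (use key(2) in auto)
  have contT: "continuous_on J T"
    by (intro continuous_at_imp_continuous_on ballI DERIV_isCont[OF derT])
  have "continuous_on J (\<lambda>s. f s - g (T s))"
    using fcont gcont contT T(1) unfolding J_def[symmetric] L_def[symmetric]
    by (intro continuous_on_diff continuous_on_compose2[of L g J T]) auto
  then have "open {s \<in> J. f s - g (T s) \<noteq> 0}"
  proof -
    assume "continuous_on J (\<lambda>s. f s - g (T s))"
    from continuous_open_preimage[OF this opJ, of "- {0}"]
    have "open (J \<inter> (\<lambda>s. f s - g (T s)) -` (- {0}))" by auto
    moreover have "J \<inter> (\<lambda>s. f s - g (T s)) -` (- {0}) = {s \<in> J. f s - g (T s) \<noteq> 0}" by blast
    ultimately show ?thesis by simp
  qed
  \<comment> \<open>Continuity upgrades equality almost everywhere to equality on \<open>J\<close>: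
    the exceptional set is both open and negligible.\<close>
  then have "{s \<in> J. f s - g (T s) \<noteq> 0} = {}" using neg open_not_negligible by blast
  then have eq: "f s = g (T s)" if "s \<in> J" for s using that by auto
  have "((\<lambda>s. T s - s) has_real_derivative 0) (at s within J)" if "s \<in> J" for s
  proof -
    have "((\<lambda>s. T s - s) has_real_derivative f s / g (T s) - 1) (at s)"
      by (auto intro!: derivative_eq_intros derT that)
    then show ?thesis using eq[OF that] fpos[OF that] by (auto intro: has_field_derivative_at_within)
  qed
  from has_field_derivative_zero_constant[OF cJ this]
  obtain c where c: "\<And>s. s \<in> J \<Longrightarrow> T s - s = c" by auto
  have Gc: "G (s + c) = F s" if "s \<in> J" for s using T(2)[OF that] c[OF that] by (simp add: algebra_simps)
  have "F s = G (s + c)" for s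
  proof (cases "s \<in> J")
    case True then show ?thesis using Gc by simp
  next
    case False
    \<comment> \<open>Outside \<open>J\<close> there is no transport to use. All of \<open>J\<close>
      lies on one side of \<open>s\<close>, and comparison with points of \<open>J\<close> at every
      level \<open>t\<close> between \<open>0\<close> and \<open>1\<close> pins both distribution
      functions to the same extreme value.\<close>
    consider "\<And>u. u \<in> J \<Longrightarrow> u \<le> s" | "\<And>u. u \<in> J \<Longrightarrow> s \<le> u"
      using inJ False by (metis linorder_le_cases)
    then show ?thesis
    proof cases
      case 1
      have "1 \<le> F s \<and> 1 \<le> G (s + c)"
      proof (intro conjI dense_le_bounded[of 0 1])
        fix t :: real assume "0 < t" "t < 1"
        then obtain u where u: "u \<in> J" "F u = t" using cF(5) by blast
        then show "t \<le> F s" "t \<le> G (s + c)"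
          using 1[OF u(1)] Gc[OF u(1)] monoD[OF cF(1), of u s] monoD[OF cG(1), of "u + c" "s + c"] by auto
      qed auto
      then show ?thesis using cF(3) cG(3) by (metis antisym)
    next
      case 2
      have "F s \<le> 0 \<and> G (s + c) \<le> 0"
      proof (intro conjI dense_ge_bounded[of 0 1])
        fix t :: real assume "0 < t" "t < 1"
        then obtain u where u: "u \<in> J" "F u = t" using cF(5) by blast
        then show "F s \<le> t" "G (s + c) \<le> t"
          using 2[OF u(1)] Gc[OF u(1)] monoD[OF cF(1), of s u] monoD[OF cG(1), of "s + c" "u + c"] by auto
      qed auto
      then show ?thesis using cF(2) cG(2) by (metis antisym)
    qed
  qed
  then show "\<exists>c. \<forall>s. integral {..s} f = integral {..s + c} g" unfolding F_def G_def by blast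
qed

section \<open>The Brunn--Minkowski inequality with its equality case\<close>

abbreviation lborel_prod :: "'i set \<Rightarrow> ('i \<Rightarrow> real) measure" where
  "lborel_prod I \<equiv> Pi\<^sub>M I (\<lambda>_. lborel)"

text \<open>Points are extensional functions on an index set, so the induction can add one index at
  a time without a change of type. The restriction keeps combinations inside the space of the
  product measure.\<close>

definition coord_comb :: "'i set \<Rightarrow> real \<Rightarrow> ('i \<Rightarrow> real) \<Rightarrow> ('i \<Rightarrow> real) \<Rightarrow> 'i \<Rightarrow> real" where
  "coord_comb I l x y = (\<lambda>i\<in>I. (1 - l) * x i + l * y i)"

text \<open>One radius \<open>R\<close> serves all sets at once: it makes their measures finite,
  makes slices beyond height \<open>R\<close> empty, and passes unchanged to the slices.\<close>

definition bounded_body :: "'i set \<Rightarrow> real \<Rightarrow> ('i \<Rightarrow> real) set \<Rightarrow> bool" where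
  "bounded_body I R A \<longleftrightarrow> A \<in> sets (lborel_prod I) \<and> A \<subseteq> (\<Pi>\<^sub>E i\<in>I. {-R..R})"

definition convex_body :: "'i set \<Rightarrow> real \<Rightarrow> ('i \<Rightarrow> real) set \<Rightarrow> bool" where
  "convex_body I R A \<longleftrightarrow> bounded_body I R A \<and>
     (\<forall>x\<in>A. \<forall>y\<in>A. \<forall>l. 0 < l \<longrightarrow> l < 1 \<longrightarrow> coord_comb I l x y \<in> A)"

definition slice :: "'i set \<Rightarrow> 'i \<Rightarrow> ('i \<Rightarrow> real) set \<Rightarrow> real \<Rightarrow> ('i \<Rightarrow> real) set" where
  "slice I i A s = {x \<in> space (lborel_prod I). x(i := s) \<in> A}"

lemma coord_comb_upd:
  "i \<notin> I \<Longrightarrow> coord_comb (insert i I) l (x(i := s)) (y(i := t)) =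
     (coord_comb I l x y)(i := (1 - l) * s + l * t)"
  by (auto simp: coord_comb_def fun_eq_iff restrict_def)

lemma coord_comb_space: "coord_comb I l x y \<in> space (lborel_prod I)"
  by (auto simp: coord_comb_def space_PiM)

lemma finite_measure_bounded_body:
  assumes "finite I" "bounded_body I R A"
  shows "emeasure (lborel_prod I) A < \<infinity>"
proof -
  interpret product_sigma_finite "\<lambda>_. lborel :: real measure" ..
  have "emeasure (lborel_prod I) A \<le> emeasure (lborel_prod I) (\<Pi>\<^sub>E i\<in>I. {-R..R})"
    using assms by (intro emeasure_mono sets_PiM_I_finite) (auto simp: bounded_body_def)
  also have "\<dots> = (\<Prod>i\<in>I. emeasure lborel {-R..R})"
    using assms by (intro emeasure_PiM) auto
  also have "\<dots> < \<infinity>"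
    by (cases "-R \<le> R") (auto simp: ennreal_power power_0_left)
  finally show ?thesis .
qed

lemma bounded_body_slice:
  assumes "i \<notin> I" "bounded_body (insert i I) R A"
  shows "bounded_body I R (slice I i A s)"
proof -
  have A: "A \<in> sets (lborel_prod (insert i I))" using assms(2) by (simp add: bounded_body_def)
  have "(\<lambda>x. x(i := s)) \<in> measurable (lborel_prod I) (lborel_prod (insert i I))"
  proof -
    have "(\<lambda>x. (x, s)) \<in> measurable (lborel_prod I) (lborel_prod I \<Otimes>\<^sub>M lborel)" by measurable
    from measurable_compose[OF this measurable_add_dim] show ?thesis by simp
  qed
  from measurable_sets[OF this A] have "slice I i A s \<in> sets (lborel_prod I)"
    by (simp add: slice_def vimage_def Int_def conj_commute)
  moreover have "slice I i A s \<subseteq> (\<Pi>\<^sub>E i\<in>I. {-R..R})"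
  proof
    fix x assume "x \<in> slice I i A s"
    then have x: "x \<in> extensional I" "x(i := s) \<in> (\<Pi>\<^sub>E i\<in>insert i I. {-R..R})"
      using assms(2) by (auto simp: slice_def bounded_body_def space_PiM PiE_def)
    show "x \<in> (\<Pi>\<^sub>E i\<in>I. {-R..R})"
    proof (rule PiE_I)
      fix j assume "j \<in> I"
      then show "x j \<in> {-R..R}" using PiE_mem[OF x(2), of j] assms(1) by (cases "j = i") auto
    qed (use x(1) in \<open>auto simp: extensional_def\<close>)
  qed
  ultimately show ?thesis by (simp add: bounded_body_def)
qed

lemma slice_outside:
  assumes "bounded_body (insert i I) R A" "R < \<bar>s\<bar>"
  shows "slice I i A s = {}"
proof -
  have False if "x(i := s) \<in> A" for x
  proof -
    have "x(i := s) \<in> (\<Pi>\<^sub>E i\<in>insert i I. {-R..R})" using that assms(1) by (auto simp: bounded_body_def)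
    from PiE_mem[OF this, of i] assms(2) show False by auto
  qed
  then show ?thesis by (auto simp: slice_def)
qed

text \<open>Fubini with the coordinates in \<open>I\<close> integrated first. All slices have finite
  measure, so real-valued measures replace extended ones and the result becomes a gauge integral, as
  the one-dimensional step requires.\<close>

lemma slice_integral:
  assumes "finite I" "i \<notin> I" "bounded_body (insert i I) R A"
  shows "((\<lambda>s. measure (lborel_prod I) (slice I i A s)) has_integral
           measure (lborel_prod (insert i I)) A) UNIV"
proof -
  interpret product_sigma_finite "\<lambda>_. lborel :: real measure" ..
  let ?P = "lborel_prod I" and ?Q = "lborel_prod (insert i I)"
  have [measurable]: "A \<in> sets ?Q" using assms(3) by (simp add: bounded_body_def)
  have sl: "slice I i A s \<in> sets ?P" for s
    using bounded_body_slice[OF assms(2,3)] by (simp add: bounded_body_def)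
  have fin: "emeasure ?P (slice I i A s) = ennreal (measure ?P (slice I i A s))" for s
    using finite_measure_bounded_body[OF assms(1) bounded_body_slice[OF assms(2,3)], of s]
    by (intro emeasure_eq_ennreal_measure) auto
  have e: "(\<integral>\<^sup>+ x. indicator A (x(i := s)) \<partial>?P) = ennreal (measure ?P (slice I i A s))" for s
  proof -
    have "(\<integral>\<^sup>+ x. indicator A (x(i := s)) \<partial>?P) = (\<integral>\<^sup>+ x. indicator (slice I i A s) x \<partial>?P)"
      by (intro nn_integral_cong) (auto simp: slice_def indicator_def)
    then show ?thesis using sl[of s] fin by simp
  qed
  have "emeasure ?Q A = (\<integral>\<^sup>+ x. indicator A x \<partial>?Q)" by simp
  also have "\<dots> = (\<integral>\<^sup>+ s. (\<integral>\<^sup>+ x. indicator A (x(i := s)) \<partial>?P) \<partial>lborel)"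
    using assms by (intro product_nn_integral_insert_rev) auto
  finally have E: "emeasure ?Q A = (\<integral>\<^sup>+ s. ennreal (measure ?P (slice I i A s)) \<partial>lborel)"
    by (simp add: e)
  have F: "emeasure ?Q A = ennreal (measure ?Q A)"
    using finite_measure_bounded_body[OF _ assms(3)] assms(1)
    by (intro emeasure_eq_ennreal_measure) auto
  interpret I: sigma_finite_measure ?P by (rule sigma_finite) (rule assms(1))
  have "(\<lambda>(x, s). x(i := s)) \<in> measurable (?P \<Otimes>\<^sub>M lborel) ?Q"
    using measurable_add_dim[of i I "\<lambda>_. lborel :: real measure"] .
  from measurable_compose[OF measurable_pair_swap' this]
  have sw: "(\<lambda>p. (snd p)(i := fst p)) \<in> measurable (lborel \<Otimes>\<^sub>M ?P) ?Q"
    by (simp add: split_beta)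
  have "(\<lambda>s. \<integral>\<^sup>+ x. indicator A (x(i := s)) \<partial>?P) \<in> borel_measurable lborel"
    by (rule I.borel_measurable_nn_integral)
      (use measurable_compose[OF sw borel_measurable_indicator[of A]] in \<open>simp add: split_beta\<close>)
  from borel_measurable_enn2real[OF this]
  have m: "(\<lambda>s. measure ?P (slice I i A s)) \<in> borel_measurable lborel"
    by (simp add: e)
  have "has_bochner_integral lborel (\<lambda>s. measure ?P (slice I i A s)) (measure ?Q A)"
    by (rule has_bochner_integral_nn_integral[OF m]) (use E F in auto)
  then show ?thesis
    using has_integral_integral_lborel[of "\<lambda>s. measure ?P (slice I i A s)"]
    by (auto simp: has_bochner_integral_iff)
qed

lemma slice_integral_atMost:
  assumes "finite I" "i \<notin> I" "bounded_body (insert i I) R A"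
  shows "integral {..t} (\<lambda>s. measure (lborel_prod I) (slice I i A s)) =
           measure (lborel_prod (insert i I)) (A \<inter> {x. x i \<le> t})"
proof -
  have "{x \<in> space (lborel_prod (insert i I)). x i \<le> t} \<in> sets (lborel_prod (insert i I))"
    by measurable
  moreover have "A \<inter> {x. x i \<le> t} = A \<inter> {x \<in> space (lborel_prod (insert i I)). x i \<le> t}"
    using assms(3) sets.sets_into_space by (auto simp: bounded_body_def)
  ultimately have "bounded_body (insert i I) R (A \<inter> {x. x i \<le> t})"
    using assms(3) by (auto simp: bounded_body_def)
  from slice_integral[OF assms(1,2) this]
  have "((\<lambda>s. measure (lborel_prod I) (slice I i (A \<inter> {x. x i \<le> t}) s)) has_integral
      measure (lborel_prod (insert i I)) (A \<inter> {x. x i \<le> t})) UNIV" .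
  moreover have "measure (lborel_prod I) (slice I i (A \<inter> {x. x i \<le> t}) s) =
     (if s \<in> {..t} then measure (lborel_prod I) (slice I i A s) else 0)" for s
    by (auto simp: slice_def)
  ultimately have "((\<lambda>s. if s \<in> {..t} then measure (lborel_prod I) (slice I i A s) else 0) has_integral
      measure (lborel_prod (insert i I)) (A \<inter> {x. x i \<le> t})) UNIV"
    by (simp only:)
  then show ?thesis by (subst (asm) has_integral_restrict_UNIV) (rule integral_unique)
qed

text \<open>\<open>D\<close> is any bounded measurable set containing the combinations, not the
  Minkowski combination itself. A slice of the latter may be larger than the combination of two
  given slices, so the induction hypothesis must accept an arbitrary container; measurability of
  sums is also avoided.\<close>

definition brunn_minkowski_on :: "'i set \<Rightarrow> bool" where
  "brunn_minkowski_on I \<longleftrightarrow> (\<forall>R A B D l. convex_body I R A \<longrightarrow> convex_body I R B \<longrightarrow> bounded_body I R D \<longrightarrow>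
     0 < l \<longrightarrow> l < 1 \<longrightarrow> (\<forall>x\<in>A. \<forall>y\<in>B. coord_comb I l x y \<in> D) \<longrightarrow>
     measure (lborel_prod I) A powr (1 - l) * measure (lborel_prod I) B powr l
       \<le> measure (lborel_prod I) D)"

lemma convex_body_slice:
  assumes "i \<notin> I" "convex_body (insert i I) R A"
  shows "convex_body I R (slice I i A s)"
  unfolding convex_body_def
proof (intro conjI ballI allI impI)
  show "bounded_body I R (slice I i A s)"
    using assms by (auto simp: convex_body_def intro: bounded_body_slice)
  fix x y l assume "x \<in> slice I i A s" "y \<in> slice I i A s" "0 < (l::real)" "l < 1"
  then have "coord_comb (insert i I) l (x(i := s)) (y(i := s)) \<in> A"
    using assms(2) by (auto simp: slice_def convex_body_def)
  then show "coord_comb I l x y \<in> slice I i A s"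
    using coord_comb_upd[OF assms(1), of l x s y s] coord_comb_space[of I l x y]
    by (simp add: slice_def algebra_simps)
qed

lemma brunn_minkowski_slice:
  assumes "i \<notin> I" "brunn_minkowski_on I"
    and "convex_body (insert i I) R A" "convex_body (insert i I) R B" "bounded_body (insert i I) R D"
    and "0 < l" "l < 1"
    and D: "\<forall>x\<in>A. \<forall>y\<in>B. coord_comb (insert i I) l x y \<in> D"
  shows "measure (lborel_prod I) (slice I i A s) powr (1 - l) *
      measure (lborel_prod I) (slice I i B t) powr l
      \<le> measure (lborel_prod I) (slice I i D ((1 - l) * s + l * t))"
proof -
  have "coord_comb I l x y \<in> slice I i D ((1 - l) * s + l * t)"
    if "x \<in> slice I i A s" "y \<in> slice I i B t" for x y
  proof -
    have "coord_comb (insert i I) l (x(i := s)) (y(i := t)) \<in> D"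
      using that D by (auto simp: slice_def)
    then show ?thesis
      using coord_comb_upd[OF assms(1), of l x s y t] coord_comb_space[of I l x y]
      by (simp add: slice_def)
  qed
  then show ?thesis
    using assms(2) convex_body_slice[OF assms(1,3)] convex_body_slice[OF assms(1,4)]
      bounded_body_slice[OF assms(1,5)] assms(6,7)
    unfolding brunn_minkowski_on_def by blast
qed

text \<open>With \<open>A\<close> in all three roles, the inequality one dimension lower says that
  the slice volume is log-concave. Hence it is positive on an interval, and the convex function
  \<open>- ln (f s)\<close> is continuous in the interior of that interval.\<close>

lemma slice_measure_convex_continuous:
  assumes "i \<notin> I" "brunn_minkowski_on I" "convex_body (insert i I) R A"
  defines "f \<equiv> \<lambda>s. measure (lborel_prod I) (slice I i A s)"
  shows "convex {s. 0 < f s}" and "continuous_on (interior {s. 0 < f s}) f"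
proof -
  have b: "bounded_body (insert i I) R A" using assms(3) by (simp add: convex_body_def)
  have bm: "f s powr (1 - l) * f t powr l \<le> f ((1 - l) * s + l * t)" if "0 < l" "l < 1" for s t l
    unfolding f_def
    by (rule brunn_minkowski_slice[OF assms(1-3) assms(3) b that])
       (use assms(3) that in \<open>auto simp: convex_body_def\<close>)
  show c: "convex {s. 0 < f s}"
    unfolding convex_alt
  proof (intro ballI allI impI)
    fix s t u :: real assume st: "s \<in> {s. 0 < f s}" "t \<in> {s. 0 < f s}" and u: "0 \<le> u \<and> u \<le> 1"
    consider "u = 0" | "u = 1" | "0 < u" "u < 1" using u by linarith
    then show "(1 - u) *\<^sub>R s + u *\<^sub>R t \<in> {s. 0 < f s}"
    proof cases
      case 3
      have "0 < f s powr (1 - u) * f t powr u" using st by simp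
      then show ?thesis using bm[OF 3, of s t] by simp
    qed (use st in auto)
  qed
  let ?J = "interior {s. 0 < f s}"
  have "convex_on ?J (\<lambda>s. - ln (f s))"
  proof (rule convex_onI)
    fix u s t :: real assume u: "0 < u" "u < 1" and "s \<in> ?J" "t \<in> ?J"
    then have st: "0 < f s" "0 < f t" using interior_subset by auto
    then have p: "0 < f s powr (1 - u) * f t powr u" by simp
    have "(1 - u) * ln (f s) + u * ln (f t) = ln (f s powr (1 - u) * f t powr u)"
      using st by (simp add: ln_mult ln_powr)
    also have "\<dots> \<le> ln (f ((1 - u) * s + u * t))"
      using p bm[OF u, of s t] by (subst ln_le_cancel_iff) auto
    finally show "- ln (f ((1 - u) *\<^sub>R s + u *\<^sub>R t)) \<le> (1 - u) * - ln (f s) + u * - ln (f t)" by simp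
  qed (use c in \<open>rule convex_interior\<close>)
  then have "continuous_on ?J (\<lambda>s. - ln (f s))" by (intro convex_on_continuous) auto
  from continuous_on_exp[OF continuous_on_minus[OF this]]
  have "continuous_on ?J (\<lambda>s. exp (ln (f s)))" by simp
  then show "continuous_on ?J f"
    by (rule continuous_on_eq) (use interior_subset[of "{s. 0 < f s}"] in \<open>auto simp: exp_ln_iff\<close>)
qed

text \<open>The slice volumes of \<open>A\<close>, \<open>B\<close> and \<open>D\<close>, divided by
  \<open>m A\<close>, \<open>m B\<close> and the geometric mean \<open>p\<close>, are the three
  functions of the one-dimensional step. For equal volumes \<open>p = m A\<close>, so equality for
  the sets is equality of the integrals. Only cuts along the axis \<open>i\<close> are obtained this
  way.\<close>

lemma brunn_minkowski_insert:
  assumes "finite I" "i \<notin> I" "brunn_minkowski_on I"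
    and A: "convex_body (insert i I) R A" and B: "convex_body (insert i I) R B"
    and D: "bounded_body (insert i I) R D"
    and l: "0 < l" "l < 1"
    and comb: "\<forall>x\<in>A. \<forall>y\<in>B. coord_comb (insert i I) l x y \<in> D"
  defines "m \<equiv> measure (lborel_prod (insert i I))"
  assumes pos: "0 < m A" "0 < m B"
  shows "m A powr (1 - l) * m B powr l \<le> m D"
    and "m B = m A \<Longrightarrow> m D = m A \<Longrightarrow>
      \<exists>c. \<forall>s. m (A \<inter> {x. x i \<le> s}) = m (B \<inter> {x. x i \<le> s + c})"
proof -
  define mA where "mA = (\<lambda>s. measure (lborel_prod I) (slice I i A s))"
  define mB where "mB = (\<lambda>s. measure (lborel_prod I) (slice I i B s))"
  define mD where "mD = (\<lambda>s. measure (lborel_prod I) (slice I i D s))"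
  define p where "p = m A powr (1 - l) * m B powr l"
  have p: "0 < p" using pos by (simp add: p_def)
  have bA: "bounded_body (insert i I) R A" and bB: "bounded_body (insert i I) R B"
    using A B by (auto simp: convex_body_def)
  have iA: "(mA has_integral m A) UNIV" and iB: "(mB has_integral m B) UNIV"
    and iD: "(mD has_integral m D) UNIV"
    unfolding mA_def mB_def mD_def m_def by (rule slice_integral[OF assms(1,2)], fact)+
  have jA: "((\<lambda>s. mA s / m A) has_integral 1) UNIV"
    and jB: "((\<lambda>s. mB s / m B) has_integral 1) UNIV"
    and jD: "((\<lambda>s. mD s / p) has_integral (m D / p)) UNIV"
    using has_integral_divide[OF iA, of "m A"] has_integral_divide[OF iB, of "m B"]
      has_integral_divide[OF iD, of p] pos by auto
  have sA: "{s. 0 < mA s / m A} = {s. 0 < mA s}" and sB: "{s. 0 < mB s / m B} = {s. 0 < mB s}"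
    using pos by (auto simp: zero_less_divide_iff)
  have vA: "\<forall>s. R < \<bar>s\<bar> \<longrightarrow> mA s / m A = 0" and vB: "\<forall>s. R < \<bar>s\<bar> \<longrightarrow> mB s / m B = 0"
    using slice_outside[OF bA] slice_outside[OF bB] by (auto simp: mA_def mB_def)
  have cA: "convex {s. 0 < mA s / m A}" and cB: "convex {s. 0 < mB s / m B}"
    unfolding sA sB unfolding mA_def mB_def
    by (rule slice_measure_convex_continuous[OF assms(2,3)], fact)+
  have kA: "continuous_on (interior {s. 0 < mA s / m A}) (\<lambda>s. mA s / m A)"
    and kB: "continuous_on (interior {s. 0 < mB s / m B}) (\<lambda>s. mB s / m B)"
    unfolding sA sB unfolding mA_def mB_def using pos
    by (auto intro!: continuous_on_divide slice_measure_convex_continuous(2)[OF assms(2,3)] A B)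
  have pl: "(mA s / m A) powr (1 - l) * (mB t / m B) powr l \<le> mD ((1 - l) * s + l * t) / p" for s t
  proof -
    have "mA s powr (1 - l) * mB t powr l \<le> mD ((1 - l) * s + l * t)"
      unfolding mA_def mB_def mD_def
      by (rule brunn_minkowski_slice[OF assms(2,3) A B D l comb])
    then show ?thesis using p pos unfolding p_def
      by (simp add: powr_divide mA_def mB_def divide_right_mono)
  qed
  have n: "0 \<le> mA s / m A" "0 \<le> mB s / m B" "0 \<le> mD s / p" for s
    using pos p by (auto simp: mA_def mB_def mD_def)
  note PL = prekopa_leindler_real[of l "\<lambda>s. mA s / m A" "\<lambda>s. mB s / m B" "\<lambda>s. mD s / p" R,
    OF l n vA vB has_integral_integrable[OF jA] has_integral_integrable[OF jB]
    has_integral_integrable[OF jD] integral_unique[OF jA] integral_unique[OF jB] cA cB kA kB pl,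
    unfolded integral_unique[OF jD]]
  show "m A powr (1 - l) * m B powr l \<le> m D"
    using PL(1) p by (simp add: p_def[symmetric])
  assume eq: "m B = m A" "m D = m A"
  then have "p = m A" using pos by (simp add: p_def powr_add[symmetric])
  then obtain c where "integral {..s} (\<lambda>s. mA s / m A) = integral {..s + c} (\<lambda>s. mB s / m B)" for s
    using PL(2) eq pos by auto
  then have "integral {..s} mA = integral {..s + c} mB" for s
    using pos eq by simp
  then show "\<exists>c. \<forall>s. m (A \<inter> {x. x i \<le> s}) = m (B \<inter> {x. x i \<le> s + c})"
    unfolding mA_def mB_def slice_integral_atMost[OF assms(1,2) bA] slice_integral_atMost[OF assms(1,2) bB] m_def
    by blast
qed

lemma brunn_minkowski_on_finite: "finite I \<Longrightarrow> brunn_minkowski_on I"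
proof (induction I rule: finite_induct)
  case empty
  show ?case unfolding brunn_minkowski_on_def
  proof (intro allI impI)
    fix R l :: real and A B D :: "('i \<Rightarrow> real) set"
    assume *: "convex_body {} R A" "convex_body {} R B" "bounded_body {} R D" "0 < l" "l < 1"
      "\<forall>x\<in>A. \<forall>y\<in>B. coord_comb {} l x y \<in> D"
    then have s: "A = {} \<or> A = {\<lambda>_. undefined}" "B = {} \<or> B = {\<lambda>_. undefined}"
      "D = {} \<or> D = {\<lambda>_. undefined}"
      by (auto simp: convex_body_def bounded_body_def sets_PiM_empty)
    \<comment> \<open>The product over no coordinates is a unit mass at one point. If
      \<open>A\<close> and \<open>B\<close> are nonempty then so is \<open>D\<close>, and the claim
      is \<open>1 \<le> 1\<close>.\<close>
    have "measure (lborel_prod {}) {\<lambda>_::'i. undefined} = 1" by (simp add: measure_def)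
    then show "measure (lborel_prod {}) A powr (1 - l) * measure (lborel_prod {}) B powr l
        \<le> measure (lborel_prod {}) D"
      using s * by auto
  qed
next
  case (insert i I)
  show ?case unfolding brunn_minkowski_on_def
  proof (intro allI impI)
    fix R l :: real and A B D :: "('a \<Rightarrow> real) set"
    let ?m = "measure (lborel_prod (insert i I))"
    assume *: "convex_body (insert i I) R A" "convex_body (insert i I) R B" "bounded_body (insert i I) R D"
      "0 < l" "l < 1" "\<forall>x\<in>A. \<forall>y\<in>B. coord_comb (insert i I) l x y \<in> D"
    show "?m A powr (1 - l) * ?m B powr l \<le> ?m D"
    \<comment> \<open>Normalisation needs positive volumes; otherwise the left side vanishes, since
      \<open>0 powr x = 0\<close>.\<close>
    proof (cases "?m A = 0 \<or> ?m B = 0")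
      case False
      then have "0 < ?m A" "0 < ?m B" by (auto simp: zero_less_measure_iff)
      then show ?thesis
        using brunn_minkowski_insert(1)[OF insert(1,2,3) *] by blast
    qed auto
  qed
qed

section \<open>Arbitrary directions and arbitrary bounded convex sets\<close>

text \<open>A linear parametrisation of the space in which the functional \<open>u\<close> becomes the coordinate at
  \<open>b\<close>; it scales volume by \<open>1 / \<bar>u \<bullet> b\<bar>\<close>, and \<open>skew b b\<close> is the standard one.\<close>

definition skew :: "'a::euclidean_space \<Rightarrow> 'a \<Rightarrow> ('a \<Rightarrow> real) \<Rightarrow> 'a" where
  "skew u b x = (\<Sum>j\<in>Basis - {b}. x j *\<^sub>R j) +
     ((x b - (\<Sum>j\<in>Basis - {b}. x j * (u \<bullet> j))) / (u \<bullet> b)) *\<^sub>R b"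

lemma measurable_skew [measurable]:
  "b \<in> Basis \<Longrightarrow> skew u b \<in> measurable (lborel_prod Basis) borel"
  unfolding skew_def by measurable

text \<open>Along each line parallel to \<open>b\<close> the map is affine with slope
  \<open>1 / (u \<bullet> b)\<close>. Integrating out that coordinate innermost yields the factor
  \<open>\<bar>u \<bullet> b\<bar>\<close> and absorbs the shear \<open>c x\<close> by translation
  invariance. What remains is the standard parametrisation of \<open>lborel\<close>.\<close>

lemma emeasure_skew:
  fixes u b :: "'a::euclidean_space"
  assumes b: "b \<in> Basis" and k: "u \<bullet> b \<noteq> 0" and A: "A \<in> sets borel"
  shows "emeasure (lborel_prod Basis) (skew u b -` A \<inter> space (lborel_prod Basis)) =
           ennreal \<bar>u \<bullet> b\<bar> * emeasure lborel A"
proof -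
  interpret product_sigma_finite "\<lambda>_. lborel :: real measure" ..
  define I where "I = Basis - {b}"
  have I: "insert b I = Basis" "finite I" "b \<notin> I" using b by (auto simp: I_def)
  define v where "v x = (\<Sum>j\<in>I. x j *\<^sub>R j)" for x :: "'a \<Rightarrow> real"
  define c where "c x = (\<Sum>j\<in>I. x j * (u \<bullet> j))" for x :: "'a \<Rightarrow> real"
  have vu: "v (x(b := y)) = v x" and cu: "c (x(b := y)) = c x" for x y
    unfolding v_def c_def using I by (auto intro!: sum.cong)
  let ?P = "lborel_prod (Basis :: 'a set)"
  have fubini: "(\<integral>\<^sup>+ x. f x \<partial>?P) = (\<integral>\<^sup>+ x. (\<integral>\<^sup>+ y. f (x(b := y)) \<partial>lborel) \<partial>lborel_prod I)"
    if "f \<in> borel_measurable ?P" for f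
    using product_nn_integral_insert[OF I(2,3), of f] that by (simp add: I(1))
  have [measurable]: "(\<lambda>f. \<Sum>b\<in>Basis. f b *\<^sub>R b) \<in> measurable ?P borel" by measurable
  note A [measurable]
  have "emeasure ?P (skew u b -` A \<inter> space ?P) = (\<integral>\<^sup>+ x. indicator A (skew u b x) \<partial>?P)"
  proof -
    have "emeasure ?P (skew u b -` A \<inter> space ?P) = (\<integral>\<^sup>+ x. indicator (skew u b -` A \<inter> space ?P) x \<partial>?P)"
      using b A by (intro nn_integral_indicator[symmetric] measurable_sets[OF measurable_skew]) auto
    then show ?thesis by (auto intro!: nn_integral_cong simp: indicator_def)
  qed
  also have "\<dots> = (\<integral>\<^sup>+ x. (\<integral>\<^sup>+ y. indicator A (v x + ((y - c x) / (u \<bullet> b)) *\<^sub>R b) \<partial>lborel) \<partial>lborel_prod I)"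
  proof -
    have "skew u b (x(b := y)) = v x + ((y - c x) / (u \<bullet> b)) *\<^sub>R b" for x y
      unfolding skew_def I_def[symmetric] v_def[symmetric] c_def[symmetric] vu cu by simp
    moreover have "(\<lambda>x. indicator A (skew u b x) :: ennreal) \<in> borel_measurable ?P"
      using measurable_compose[OF measurable_skew[OF b] borel_measurable_indicator[OF A]] .
    ultimately show ?thesis by (simp add: fubini)
  qed
  also have "\<dots> = (\<integral>\<^sup>+ x. \<bar>u \<bullet> b\<bar> * (\<integral>\<^sup>+ y. indicator A (v x + y *\<^sub>R b) \<partial>lborel) \<partial>lborel_prod I)"
  proof (rule nn_integral_cong)
    fix x
    show "(\<integral>\<^sup>+ y. indicator A (v x + ((y - c x) / (u \<bullet> b)) *\<^sub>R b) \<partial>lborel) =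
        \<bar>u \<bullet> b\<bar> * (\<integral>\<^sup>+ y. indicator A (v x + y *\<^sub>R b) \<partial>lborel)"
      by (subst nn_integral_real_affine[where c = "u \<bullet> b" and t = "c x"]) (use k in auto)
  qed
  also have "\<dots> = \<bar>u \<bullet> b\<bar> * (\<integral>\<^sup>+ x. (\<integral>\<^sup>+ y. indicator A (v x + y *\<^sub>R b) \<partial>lborel) \<partial>lborel_prod I)"
  proof (rule nn_integral_cmult)
    interpret I: sigma_finite_measure "lborel_prod I" by (rule sigma_finite) (rule I(2))
    have "v \<in> measurable (lborel_prod I) borel" unfolding v_def by measurable
    then show "(\<lambda>x. \<integral>\<^sup>+ y. indicator A (v x + y *\<^sub>R b) \<partial>lborel) \<in> borel_measurable (lborel_prod I)"
      by measurable
  qed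
  also have "(\<integral>\<^sup>+ x. (\<integral>\<^sup>+ y. indicator A (v x + y *\<^sub>R b) \<partial>lborel) \<partial>lborel_prod I) =
      (\<integral>\<^sup>+ x. indicator A (\<Sum>j\<in>Basis. x j *\<^sub>R j) \<partial>?P)"
  proof -
    have "(\<Sum>j\<in>Basis. (x(b := y)) j *\<^sub>R j) = v x + y *\<^sub>R b" for x y
    proof -
      have "(\<Sum>j\<in>insert b I. (x(b := y)) j *\<^sub>R j) = y *\<^sub>R b + v (x(b := y))"
        unfolding v_def using I(2,3) by simp
      then show ?thesis by (simp add: I(1) vu add.commute)
    qed
    then show ?thesis by (subst fubini) simp_all
  qed
  also have "\<dots> = (\<integral>\<^sup>+ x. indicator A x \<partial>(lborel :: 'a measure))"
    by (subst lborel_eq, subst nn_integral_distr) simp_all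
  finally show ?thesis using A by simp
qed

lemma skew_coord_comb:
  assumes "b \<in> Basis"
  shows "skew u b (coord_comb Basis l x y) = (1 - l) *\<^sub>R skew u b x + l *\<^sub>R skew u b y"
proof -
  have 1: "(\<Sum>j\<in>Basis - {b}. coord_comb Basis l x y j *\<^sub>R j) =
      (1 - l) *\<^sub>R (\<Sum>j\<in>Basis - {b}. x j *\<^sub>R j) + l *\<^sub>R (\<Sum>j\<in>Basis - {b}. y j *\<^sub>R j)"
    by (simp add: coord_comb_def scaleR_sum_right scaleR_add_left sum.distrib)
  have 2: "(\<Sum>j\<in>Basis - {b}. coord_comb Basis l x y j * (u \<bullet> j)) =
      (1 - l) * (\<Sum>j\<in>Basis - {b}. x j * (u \<bullet> j)) + l * (\<Sum>j\<in>Basis - {b}. y j * (u \<bullet> j))"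
    by (simp add: coord_comb_def sum_distrib_left sum.distrib sum_subtractf algebra_simps)
  have 3: "coord_comb Basis l x y b = (1 - l) * x b + l * y b" using assms by (simp add: coord_comb_def)
  have 4: "((1 - l) * p + l * q - ((1 - l) * r + l * s)) / k =
      (1 - l) * ((p - r) / k) + l * ((q - s) / k)" for p q r s k :: real
    by (simp add: field_simps add_divide_distrib diff_divide_distrib)
  show ?thesis unfolding skew_def 1 2 3 4
    by (simp add: scaleR_add_left scaleR_add_right del: scaleR_scaleR) (simp add: algebra_simps)
qed

lemma skew_inner:
  assumes "b \<in> Basis" "u \<bullet> b \<noteq> 0"
  shows "u \<bullet> skew u b x = x b" and "j \<in> Basis \<Longrightarrow> j \<noteq> b \<Longrightarrow> j \<bullet> skew u b x = x j"
proof -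
  show "u \<bullet> skew u b x = x b"
    using assms(2) by (simp add: skew_def inner_add_right inner_sum_right)
  assume j: "j \<in> Basis" "j \<noteq> b"
  have "j \<bullet> (\<Sum>i\<in>Basis - {b}. x i *\<^sub>R i) = (\<Sum>i\<in>Basis - {b}. if i = j then x i else 0)"
    unfolding inner_sum_right using j by (intro sum.cong) (auto simp: inner_Basis)
  also have "\<dots> = x j" using j by simp
  finally show "j \<bullet> skew u b x = x j"
    using j assms(1) by (simp add: skew_def inner_add_right inner_Basis)
qed

text \<open>Pulling back along \<open>skew u b\<close> makes \<open>u\<close> the coordinate at
  \<open>b\<close>, so cuts along one axis become cuts by the half-spaces of \<open>u\<close>. The
  volume factor \<open>k\<close> enters both sides with total exponent one and cancels.\<close>

lemma brunn_minkowski_borel: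
  fixes A B D :: "'a::euclidean_space set"
  assumes A: "A \<in> sets borel" "bounded A" "convex A"
    and B: "B \<in> sets borel" "bounded B" "convex B"
    and D: "D \<in> sets borel" "bounded D"
    and l: "0 < l" "l < 1"
    and comb: "\<forall>x\<in>A. \<forall>y\<in>B. (1 - l) *\<^sub>R x + l *\<^sub>R y \<in> D"
  shows "measure lborel A powr (1 - l) * measure lborel B powr l \<le> measure lborel D"
    and "u \<noteq> 0 \<Longrightarrow> 0 < measure lborel A \<Longrightarrow> measure lborel B = measure lborel A \<Longrightarrow>
      measure lborel D = measure lborel A \<Longrightarrow>
      \<exists>c. \<forall>s. measure lborel (A \<inter> {x. u \<bullet> x \<le> s}) = measure lborel (B \<inter> {x. u \<bullet> x \<le> s + c})"
proof -
  have main: "measure lborel A powr (1 - l) * measure lborel B powr l \<le> measure lborel D \<and>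
     (0 < measure lborel A \<longrightarrow> measure lborel B = measure lborel A \<longrightarrow>
      measure lborel D = measure lborel A \<longrightarrow>
      (\<exists>c. \<forall>s. measure lborel (A \<inter> {x. u \<bullet> x \<le> s}) = measure lborel (B \<inter> {x. u \<bullet> x \<le> s + c})))"
    if u: "u \<noteq> 0" for u :: 'a
  proof -
    obtain b where b: "b \<in> Basis" "u \<bullet> b \<noteq> 0" using u euclidean_all_zero_iff[of u] by auto
    let ?P = "lborel_prod (Basis :: 'a set)"
    let ?m = "measure ?P"
    define k where "k = \<bar>u \<bullet> b\<bar>"
    define pre where "pre X = skew u b -` X \<inter> space ?P" for X
    have k: "0 < k" using b by (simp add: k_def)
    have mpre: "?m (pre X) = k * measure lborel X" if "X \<in> sets borel" for X
      unfolding pre_def measure_def emeasure_skew[OF b that] by (simp add: k_def enn2real_mult)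
    obtain R where R: "\<And>x. x \<in> A \<union> B \<union> D \<Longrightarrow> norm x \<le> R"
      using A B D bounded_Un unfolding bounded_iff by (metis (no_types, lifting) bounded_Un bounded_iff)
    \<comment> \<open>The coordinate at \<open>b\<close> is the value of \<open>u\<close>, bounded
      by \<open>norm u * R\<close>; the other coordinates are bounded by \<open>R\<close>. The sum
      of the two bounds serves for both.\<close>
    define Q where "Q = (norm u + 1) * R"
    have bb: "bounded_body Basis Q (pre X)" if X: "X \<in> sets borel" "X \<subseteq> A \<union> B \<union> D" for X
      unfolding bounded_body_def
    proof
      show "pre X \<in> sets ?P" unfolding pre_def using b X by (intro measurable_sets[OF measurable_skew])
      show "pre X \<subseteq> (\<Pi>\<^sub>E i\<in>Basis. {-Q..Q})"
      proof
        fix x assume x: "x \<in> pre X"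
        then have n: "norm (skew u b x) \<le> R" using R X by (auto simp: pre_def)
        then have R0: "0 \<le> R" using norm_ge_zero order_trans by blast
        have "\<bar>x j\<bar> \<le> Q" if j: "j \<in> Basis" for j
        proof (cases "j = b")
          case True
          have "\<bar>x b\<bar> \<le> norm u * norm (skew u b x)"
            using Cauchy_Schwarz_ineq2[of u "skew u b x"] skew_inner(1)[OF b] by simp
          also have "\<dots> \<le> norm u * R" using n by (intro mult_left_mono) auto
          finally show ?thesis using True R0 by (simp add: Q_def algebra_simps)
        next
          case False
          have "\<bar>x j\<bar> \<le> norm j * norm (skew u b x)"
            using Cauchy_Schwarz_ineq2[of j "skew u b x"] skew_inner(2)[OF b j False] by simp
          also have "\<dots> \<le> R" using n j by simp
          also have "\<dots> \<le> Q" using R0 by (simp add: Q_def algebra_simps)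
          finally show ?thesis .
        qed
        then show "x \<in> (\<Pi>\<^sub>E i\<in>Basis. {-Q..Q})"
          using x by (auto simp: pre_def space_PiM PiE_def Pi_def abs_le_iff minus_le_iff)
      qed
    qed
    have cb: "convex_body Basis Q (pre X)" if X: "X \<in> sets borel" "X \<subseteq> A \<union> B \<union> D" "convex X" for X
      unfolding convex_body_def
    proof (intro conjI ballI allI impI bb X(1,2))
      fix x y r assume "x \<in> pre X" "y \<in> pre X" "0 < (r::real)" "r < 1"
      then show "coord_comb Basis r x y \<in> pre X"
        using X(3) by (auto simp: pre_def skew_coord_comb[OF b(1)] coord_comb_space convex_alt)
    qed
    have comb': "\<forall>x\<in>pre A. \<forall>y\<in>pre B. coord_comb Basis l x y \<in> pre D"
      using comb by (auto simp: pre_def skew_coord_comb[OF b(1)] coord_comb_space)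
    define I where "I = Basis - {b}"
    have I: "insert b I = Basis" "finite I" "b \<notin> I" using b by (auto simp: I_def)
    have AB: "convex_body Basis Q (pre A)" "convex_body Basis Q (pre B)" "bounded_body Basis Q (pre D)"
      using A B D by (auto intro: cb bb)
    have 1: "?m (pre A) powr (1 - l) * ?m (pre B) powr l \<le> ?m (pre D)"
      using brunn_minkowski_on_finite[OF finite_Basis] AB l comb'
      unfolding brunn_minkowski_on_def by blast
    have "?m (pre A) powr (1 - l) * ?m (pre B) powr l =
        k * (measure lborel A powr (1 - l) * measure lborel B powr l)"
    proof -
      have "k powr (1 - l) * k powr l = k" using k by (simp add: powr_add[symmetric])
      moreover have "(k * p) powr (1 - l) * (k * q) powr l =
          (k powr (1 - l) * k powr l) * (p powr (1 - l) * q powr l)" if "0 \<le> p" "0 \<le> q" for p q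
        using k that by (simp add: powr_mult mult_ac)
      ultimately show ?thesis by (simp add: mpre A B)
    qed
    with 1 have "measure lborel A powr (1 - l) * measure lborel B powr l \<le> measure lborel D"
      using k D by (simp add: mpre)
    moreover have "\<exists>c. \<forall>s. measure lborel (A \<inter> {x. u \<bullet> x \<le> s}) = measure lborel (B \<inter> {x. u \<bullet> x \<le> s + c})"
      if eq: "0 < measure lborel A" "measure lborel B = measure lborel A" "measure lborel D = measure lborel A"
    proof -
      have half: "pre X \<inter> {x. x b \<le> s} = pre (X \<inter> {x. u \<bullet> x \<le> s})" for X s
        by (auto simp: pre_def skew_inner(1)[OF b])
      have hs: "X \<inter> {x. u \<bullet> x \<le> s} \<in> sets borel" if "X \<in> sets borel" for X s
        by (rule sets.Int[OF that borel_closed[OF closed_halfspace_le]])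
      have "\<exists>c. \<forall>s. ?m (pre A \<inter> {x. x b \<le> s}) = ?m (pre B \<inter> {x. x b \<le> s + c})"
        using brunn_minkowski_insert(2)[OF I(2,3) brunn_minkowski_on_finite[OF I(2)], unfolded I(1),
          OF AB l comb'] eq k by (simp add: mpre A B D)
      then show ?thesis using k by (simp add: half mpre hs A B)
    qed
    ultimately show ?thesis by blast
  qed
  show "measure lborel A powr (1 - l) * measure lborel B powr l \<le> measure lborel D"
  proof -
    \<comment> \<open>The inequality mentions no direction, so any nonzero vector may play the role
      of \<open>u\<close>.\<close>
    obtain b :: 'a where "b \<in> Basis" using nonempty_Basis by blast
    then show ?thesis using main[of b] nonzero_Basis by blast
  qed
  show "u \<noteq> 0 \<Longrightarrow> 0 < measure lborel A \<Longrightarrow> measure lborel B = measure lborel A \<Longrightarrow>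
      measure lborel D = measure lborel A \<Longrightarrow>
      \<exists>c. \<forall>s. measure lborel (A \<inter> {x. u \<bullet> x \<le> s}) = measure lborel (B \<inter> {x. u \<bullet> x \<le> s + c})"
    using main by blast
qed

text \<open>The frontier of a convex set is null, so taking closures changes no volume, even inside
  a half-space. This carries the Borel version over to convex sets that may fail to be
  Borel.\<close>

lemma measure_closure_convex_Int:
  fixes A H :: "'a::euclidean_space set"
  assumes "convex A" "bounded A" "H \<in> sets borel"
  shows "measure lborel (closure A \<inter> H) = measure lebesgue (A \<inter> H)"
proof -
  have "A \<inter> H \<in> lmeasurable"
    using measurable_convex[OF assms(1,2)] assms(3) by (intro fmeasurable_Int_fmeasurable) auto
  moreover have "negligible (A \<inter> H - closure A \<inter> H \<union> (closure A \<inter> H - A \<inter> H))"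
    by (rule negligible_subset[OF negligible_convex_frontier[OF assms(1)]])
      (use closure_subset[of A] interior_subset[of A] in \<open>auto simp: frontier_def\<close>)
  ultimately have "measure lebesgue (closure A \<inter> H) = measure lebesgue (A \<inter> H)"
    by (rule measure_negligible_symdiff)
  then show ?thesis using assms(3) by (simp add: sets.Int borel_closed)
qed

lemma brunn_minkowski_convex:
  fixes A B :: "'a::euclidean_space set"
  assumes A: "convex A" "bounded A" and B: "convex B" "bounded B" and l: "0 < l" "l < 1"
  defines "D \<equiv> (*\<^sub>R) (1 - l) ` A + (*\<^sub>R) l ` B"
  shows "measure lebesgue A powr (1 - l) * measure lebesgue B powr l \<le> measure lebesgue D"
    and "u \<noteq> 0 \<Longrightarrow> 0 < measure lebesgue A \<Longrightarrow> measure lebesgue B = measure lebesgue A \<Longrightarrow>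
      measure lebesgue D = measure lebesgue A \<Longrightarrow>
      \<exists>c. \<forall>s. measure lebesgue (A \<inter> {x. u \<bullet> x \<le> s}) = measure lebesgue (B \<inter> {x. u \<bullet> x \<le> s + c})"
proof -
  have "bounded D"
    unfolding D_def set_plus_image using A B by (intro bounded_plus bounded_scaling)
  moreover have "convex D"
    unfolding D_def using A B by (intro convex_set_plus convex_scaling)
  ultimately have D: "convex D" "bounded D" by auto
  have comb: "\<forall>x\<in>closure A. \<forall>y\<in>closure B. (1 - l) *\<^sub>R x + l *\<^sub>R y \<in> closure D"
  proof (intro ballI)
    fix x y assume xy: "x \<in> closure A" "y \<in> closure B"
    have "(1 - l) *\<^sub>R x + l *\<^sub>R y \<in> closure ((*\<^sub>R) (1 - l) ` A) + closure ((*\<^sub>R) l ` B)"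
      unfolding closure_scaleR[symmetric] using xy by (intro set_plus_intro imageI)
    then show "(1 - l) *\<^sub>R x + l *\<^sub>R y \<in> closure D" unfolding D_def using closure_sum by blast
  qed
  note H = measure_closure_convex_Int[OF A] measure_closure_convex_Int[OF B]
  have m: "measure lborel (closure A) = measure lebesgue A"
    "measure lborel (closure B) = measure lebesgue B" "measure lborel (closure D) = measure lebesgue D"
    using measure_closure_convex_Int[OF A, of UNIV] measure_closure_convex_Int[OF B, of UNIV]
      measure_closure_convex_Int[OF D, of UNIV] by auto
  have cl: "closure X \<in> sets borel" for X :: "'a set" by simp
  note bm = brunn_minkowski_borel[OF cl bounded_closure[OF A(2)] convex_closure[OF A(1)]
    cl bounded_closure[OF B(2)] convex_closure[OF B(1)] cl bounded_closure[OF D(2)] l comb, unfolded m]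
  show "measure lebesgue A powr (1 - l) * measure lebesgue B powr l \<le> measure lebesgue D"
    by (rule bm(1))
  assume eq: "u \<noteq> 0" "0 < measure lebesgue A" "measure lebesgue B = measure lebesgue A"
      "measure lebesgue D = measure lebesgue A"
  have "\<exists>c. \<forall>s. measure lborel (closure A \<inter> {x. u \<bullet> x \<le> s}) = measure lborel (closure B \<inter> {x. u \<bullet> x \<le> s + c})"
    by (rule bm(2)[OF eq])
  moreover have "{x. u \<bullet> x \<le> s} \<in> sets borel" for s by (intro borel_closed closed_halfspace_le)
  ultimately show "\<exists>c. \<forall>s. measure lebesgue (A \<inter> {x. u \<bullet> x \<le> s}) = measure lebesgue (B \<inter> {x. u \<bullet> x \<le> s + c})"
    using H by simp
qed

section \<open>Coconvex bodies\<close>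

lemma measure_pos_of_open:
  fixes S U :: "'a::euclidean_space set"
  assumes "open U" "U \<noteq> {}" "U \<subseteq> S" "S \<in> lmeasurable"
  shows "0 < measure lebesgue S"
proof -
  have "\<not> negligible S" using assms open_not_negligible negligible_subset by blast
  then have "measure lebesgue S \<noteq> 0" using assms(4) negligible_iff_measure by blast
  then show ?thesis by (simp add: zero_less_measure_iff)
qed

lemma sets_lebesgue_convex:
  fixes S :: "'a::euclidean_space set"
  assumes "convex S"
  shows "S \<in> sets lebesgue"
proof -
  have "S - interior S \<subseteq> frontier S" using closure_subset by (auto simp: frontier_def)
  then have "negligible (S - interior S)"
    using negligible_convex_frontier[OF assms] negligible_subset by blast
  then have "S - interior S \<in> sets lebesgue" by (rule negligible_imp_sets)
  moreover have "interior S \<in> sets lebesgue" by auto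
  ultimately have "(S - interior S) \<union> interior S \<in> sets lebesgue" by (rule sets.Un)
  moreover have "(S - interior S) \<union> interior S = S" using interior_subset by blast
  ultimately show ?thesis by simp
qed

lemma interior_dilate:
  fixes S :: "'a::euclidean_space set"
  assumes "t \<noteq> 0"
  shows "interior (dilate t S) = dilate t (interior S)"
  by (rule interior_injective_linear_image) (use assms in \<open>auto simp: inj_on_def intro: linear_scaleR\<close>)

section \<open>Functionals positive on the cone, and truncated complements\<close>

text \<open>For a closed cone this says that \<open>w\<close> lies in the interior of the dual cone.\<close>

definition dominates_norm :: "'a::real_inner set \<Rightarrow> 'a \<Rightarrow> bool" where
  "dominates_norm C w \<longleftrightarrow> (\<exists>k>0. \<forall>x\<in>C. k * norm x \<le> w \<bullet> x)"

lemma dominates_norm_nonneg: "dominates_norm C w \<Longrightarrow> x \<in> C \<Longrightarrow> 0 \<le> w \<bullet> x"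
  unfolding dominates_norm_def by (meson norm_ge_zero order_trans less_imp_le mult_nonneg_nonneg)

text \<open>Strict separation of \<open>0\<close> from the compact set
  \<open>convex hull (C \<inter> sphere 0 1)\<close>. The hull misses \<open>0\<close> because
  \<open>C - {0}\<close> is convex, which is where the absence of lines enters; the bound on the
  sphere extends to \<open>C\<close> by homogeneity.\<close>

lemma dominates_norm_exists:
  fixes C :: "'a::euclidean_space set"
  assumes "convex_cone C" "closed C" "\<not> contains_line C"
  obtains w where "dominates_norm C w"
proof -
  have cv: "convex (C - {0})"
    unfolding convex_alt
  proof (intro ballI allI impI)
    fix x y :: 'a and u :: real
    assume x: "x \<in> C - {0}" and y: "y \<in> C - {0}" and u: "0 \<le> u \<and> u \<le> 1"
    have "(1 - u) *\<^sub>R x + u *\<^sub>R y \<in> C"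
      using x y u assms(1) by (auto intro!: convex_cone_add convex_cone_scaleR)
    moreover have "(1 - u) *\<^sub>R x + u *\<^sub>R y \<noteq> 0"
    proof
      assume 0: "(1 - u) *\<^sub>R x + u *\<^sub>R y = 0"
      have u1: "u \<noteq> 1" using 0 y by auto
      have "(1 / (1 - u)) *\<^sub>R ((1 - u) *\<^sub>R x + u *\<^sub>R y) = 0" unfolding 0 by simp
      then have "x + (u / (1 - u)) *\<^sub>R y = 0" using u1 by (simp add: scaleR_add_right)
      \<comment> \<open>A vanishing combination makes \<open>- x\<close> a nonnegative multiple of
        \<open>y\<close>, so \<open>C\<close> would contain the line through \<open>0\<close> and
        \<open>x\<close>.\<close>
      then have "- x = (u / (1 - u)) *\<^sub>R y" by (simp add: minus_equation_iff add_eq_0_iff)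
      then have m: "- x \<in> C" using y u u1 assms(1) by (auto intro!: convex_cone_scaleR)
      have "0 + t *\<^sub>R x \<in> C" for t
      proof (cases "0 \<le> t")
        case True then show ?thesis using x assms(1) by (auto intro!: convex_cone_scaleR)
      next
        case False
        then have "(- t) *\<^sub>R (- x) \<in> C" using m assms(1) by (intro convex_cone_scaleR) auto
        then show ?thesis by simp
      qed
      then show False using assms(3) x unfolding contains_line_def by blast
    qed
    ultimately show "(1 - u) *\<^sub>R x + u *\<^sub>R y \<in> C - {0}" by simp
  qed
  let ?S = "convex hull (C \<inter> sphere 0 1)"
  have "?S \<subseteq> C - {0}" by (rule hull_minimal) (use cv in auto)
  moreover have "closed ?S"
    by (rule compact_imp_closed[OF compact_convex_hull[OF closed_Int_compact[OF assms(2) compact_sphere]]])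
  ultimately obtain a b where ab: "0 < b" "\<And>x. x \<in> ?S \<Longrightarrow> b < a \<bullet> x"
    using separating_hyperplane_closed_0[of ?S] by blast
  have "b * norm x \<le> a \<bullet> x" if "x \<in> C" for x
  proof (cases "x = 0")
    case False
    have "(1 / norm x) *\<^sub>R x \<in> C \<inter> sphere 0 1"
      using False that assms(1) by (auto intro!: convex_cone_scaleR)
    then have "b < a \<bullet> ((1 / norm x) *\<^sub>R x)" by (intro ab hull_inc)
    then show ?thesis using False by (simp add: field_simps)
  qed auto
  then show ?thesis using that ab(1) unfolding dominates_norm_def by blast
qed

lemma bounded_truncated_cone:
  assumes "dominates_norm C w"
  shows "bounded (C \<inter> {x. w \<bullet> x \<le> z})"
proof -
  obtain k where k: "0 < k" "\<And>x. x \<in> C \<Longrightarrow> k * norm x \<le> w \<bullet> x"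
    using assms unfolding dominates_norm_def by blast
  have "norm x \<le> z / k" if "x \<in> C \<inter> {x. w \<bullet> x \<le> z}" for x
    using k(2)[of x] that k(1) by (auto simp: field_simps)
  then show ?thesis unfolding bounded_iff by blast
qed

locale solid_cone =
  fixes C :: "'a::euclidean_space set"
  assumes pointed: "pointed_solid_cone C"
begin

lemma cone: "convex_cone C" "closed C" "interior C \<noteq> {}" "\<not> contains_line C" "convex C"
  using pointed by (auto simp: pointed_solid_cone_def convex_cone_def)

lemma cone_scale: "x \<in> C \<Longrightarrow> 0 \<le> t \<Longrightarrow> t *\<^sub>R x \<in> C"
  using cone(1) by (rule convex_cone_scaleR)

lemma coconvex_lmeasurable: "coconvex_body C K \<Longrightarrow> K \<in> lmeasurable"
  by (auto simp: coconvex_body_def compact_eq_bounded_closed intro!: lmeasurable_compact)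

lemma truncation:
  assumes "convex X" "X \<subseteq> C" "dominates_norm C w"
  shows "convex (X \<inter> {x. w \<bullet> x \<le> z})" "bounded (X \<inter> {x. w \<bullet> x \<le> z})"
    "X \<inter> {x. w \<bullet> x \<le> z} \<in> lmeasurable"
proof -
  show 1: "convex (X \<inter> {x. w \<bullet> x \<le> z})" using assms(1) by (intro convex_Int convex_halfspace_le)
  show 2: "bounded (X \<inter> {x. w \<bullet> x \<le> z})"
    by (rule bounded_subset[OF bounded_truncated_cone[OF assms(3)]]) (use assms(2) in auto)
  show "X \<inter> {x. w \<bullet> x \<le> z} \<in> lmeasurable" using 1 2 by (rule measurable_convex)
qed

text \<open>Scaling preserves the interior of a cone, so a nonzero interior point can be moved to
  the level halfway between \<open>a\<close> and \<open>b\<close>, which is positive because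
  \<open>0 \<le> a < b\<close>. Such slabs supply the positive volume behind strict
  inequalities.\<close>

lemma interior_slab:
  assumes "dominates_norm C w" "0 \<le> a" "a < b"
  shows "open (interior C \<inter> {x. a < w \<bullet> x} \<inter> {x. w \<bullet> x < b})"
    and "interior C \<inter> {x. a < w \<bullet> x} \<inter> {x. w \<bullet> x < b} \<noteq> {}"
proof -
  show "open (interior C \<inter> {x. a < w \<bullet> x} \<inter> {x. w \<bullet> x < b})"
    using open_halfspace_gt[of a w] open_halfspace_lt[of w b] by (intro open_Int open_interior) auto
  obtain p where p: "p \<in> interior C" "p \<noteq> 0"
  proof -
    have "\<not> interior C \<subseteq> {0}"
      using cone(3) by (metis interior_singleton interior_interior interior_mono subset_empty)
    then show ?thesis using that by blast
  qed
  obtain k where k: "0 < k" "\<And>x. x \<in> C \<Longrightarrow> k * norm x \<le> w \<bullet> x"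
    using assms unfolding dominates_norm_def by blast
  have wp: "0 < w \<bullet> p"
    using k p interior_subset by (metis less_le_trans mult_pos_pos subsetD zero_less_norm_iff)
  define t where "t = ((a + b) / 2) / (w \<bullet> p)"
  have t: "0 < t" using wp assms by (simp add: t_def)
  have "(*\<^sub>R) t ` C = C"
  proof -
    have "x \<in> (*\<^sub>R) t ` C" if "x \<in> C" for x
      using t cone_scale[OF that, of "1 / t"] by (intro image_eqI[of _ _ "(1 / t) *\<^sub>R x"]) auto
    then show ?thesis using cone_scale t by auto
  qed
  then have "interior C = (*\<^sub>R) t ` interior C" using interior_dilate[of t C] t by simp
  then have "t *\<^sub>R p \<in> interior C" using imageI[OF p(1), of "(*\<^sub>R) t"] by simp
  moreover have "w \<bullet> (t *\<^sub>R p) = (a + b) / 2" using wp by (simp add: t_def)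
  ultimately show "interior C \<inter> {x. a < w \<bullet> x} \<inter> {x. w \<bullet> x < b} \<noteq> {}"
    using assms(3) by (intro ex_in_conv[THEN iffD1] exI[of _ "t *\<^sub>R p"]) auto
qed

lemma measure_truncated_complement:
  assumes "coconvex_body C K" "dominates_norm C w" "K \<subseteq> {x. w \<bullet> x \<le> z}"
  shows "measure lebesgue ((C - K) \<inter> {x. w \<bullet> x \<le> z}) =
    measure lebesgue (C \<inter> {x. w \<bullet> x \<le> z}) - measure lebesgue K"
proof -
  have "K \<subseteq> C" using assms(1) by (auto simp: coconvex_body_def)
  then have "measure lebesgue (C \<inter> {x. w \<bullet> x \<le> z} - K) =
      measure lebesgue (C \<inter> {x. w \<bullet> x \<le> z}) - measure lebesgue K"
    using assms truncation(3)[OF cone(5) order_refl assms(2)] coconvex_lmeasurable[OF assms(1)]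
    by (intro measurable_measure_Diff) auto
  moreover have "C \<inter> {x. w \<bullet> x \<le> z} - K = (C - K) \<inter> {x. w \<bullet> x \<le> z}" by auto
  ultimately show ?thesis by simp
qed

lemma coconvex_height:
  assumes "coconvex_body C K"
  obtains z where "0 \<le> z" "K \<subseteq> {x. w \<bullet> x \<le> z}"
proof -
  obtain r where r: "\<And>x. x \<in> K \<Longrightarrow> norm x \<le> r"
    using assms by (auto simp: coconvex_body_def bounded_iff)
  have "w \<bullet> x \<le> norm w * \<bar>r\<bar>" if "x \<in> K" for x
  proof -
    have "w \<bullet> x \<le> norm w * norm x" by (rule norm_cauchy_schwarz)
    also have "\<dots> \<le> norm w * \<bar>r\<bar>" using r[OF that] by (intro mult_left_mono) auto
    finally show ?thesis .
  qed
  then show ?thesis by (intro that[of "norm w * \<bar>r\<bar>"]) auto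
qed

text \<open>Above the height \<open>z\<close> of \<open>K\<close> the complement is the whole cone,
  so raising the cut to \<open>y\<close> adds at least the slab of the open cone between
  \<open>max z s\<close> and \<open>y\<close>.\<close>

lemma truncated_complement_strict:
  assumes K: "coconvex_body C K" and w: "dominates_norm C w" and z: "0 \<le> z" "K \<subseteq> {x. w \<bullet> x \<le> z}"
    and s: "s < y" "z < y"
  shows "measure lebesgue ((C - K) \<inter> {x. w \<bullet> x \<le> s}) < measure lebesgue ((C - K) \<inter> {x. w \<bullet> x \<le> y})"
proof -
  let ?A = "\<lambda>s. (C - K) \<inter> {x. w \<bullet> x \<le> s}"
  have cK: "convex (C - K)" using K by (simp add: coconvex_body_def)
  have m: "?A s \<in> lmeasurable" for s by (rule truncation(3)[OF cK _ w]) auto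
  let ?U = "interior C \<inter> {x. max z s < w \<bullet> x} \<inter> {x. w \<bullet> x < y}"
  have "?U \<subseteq> ?A y - ?A s" using interior_subset z by auto
  moreover have "open ?U" "?U \<noteq> {}" using interior_slab[OF w, of "max z s" y] z s by auto
  ultimately have "0 < measure lebesgue (?A y - ?A s)"
    using m by (intro measure_pos_of_open fmeasurable.Diff) auto
  also have "measure lebesgue (?A y - ?A s) = measure lebesgue (?A y) - measure lebesgue (?A s)"
    using m s by (intro measurable_measure_Diff) auto
  finally show ?thesis by simp
qed

text \<open>The inclusion \<open>C - X \<subseteq> K \<union> L\<close> lets one cut account for all
  three bodies: each has as volume what its truncated complement lacks in the truncated cone. The
  volume of \<open>D\<close> lies between \<open>M\<close> and that of the truncated
  \<open>X\<close>; equality in the conclusion collapses this chain and puts \<open>A\<close>,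
  \<open>B\<close>, \<open>D\<close> in the equality case.\<close>

lemma coconvex_combination:
  assumes K: "coconvex_body C K" and L: "coconvex_body C L" and l: "0 < l" "l < 1"
    and V: "measure lebesgue L = measure lebesgue K"
  defines "X \<equiv> dilate (1 - l) (C - K) + dilate l (C - L)"
  shows "measure lebesgue (C - X) \<le> measure lebesgue K"
    and "measure lebesgue (C - X) = measure lebesgue K \<Longrightarrow> dominates_norm C w \<Longrightarrow>
      measure lebesgue ((C - K) \<inter> {x. w \<bullet> x \<le> s}) = measure lebesgue ((C - L) \<inter> {x. w \<bullet> x \<le> s})"
proof -
  have cK: "convex (C - K)" and cL: "convex (C - L)"
    using K L by (auto simp: coconvex_body_def)
  have cX: "convex X" unfolding X_def using cK cL by (intro convex_set_plus convex_scaling)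
  have XC: "X \<subseteq> C"
  proof
    fix x assume "x \<in> X"
    then obtain a b where "a \<in> C" "b \<in> C" "x = (1 - l) *\<^sub>R a + l *\<^sub>R b"
      unfolding X_def set_plus_def by blast
    then show "x \<in> C" using l by (simp add: convex_cone_add[OF cone(1)] cone_scale)
  qed
  have NKL: "C - X \<subseteq> K \<union> L"
  proof
    fix x assume x: "x \<in> C - X"
    \<comment> \<open>A point outside both bodies is a convex combination of itself with
      itself.\<close>
    have "x \<in> X" if "x \<in> C - K" "x \<in> C - L"
    proof -
      have "(1 - l) *\<^sub>R x + l *\<^sub>R x \<in> X"
        unfolding X_def by (intro set_plus_intro imageI that)
      then show ?thesis by (simp add: scaleR_left_distrib[symmetric])
    qed
    then show "x \<in> K \<union> L" using x by blast
  qed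
  have main: "measure lebesgue (C - X) \<le> measure lebesgue K \<and>
      (measure lebesgue (C - X) = measure lebesgue K \<longrightarrow>
      measure lebesgue ((C - K) \<inter> {x. w \<bullet> x \<le> s}) = measure lebesgue ((C - L) \<inter> {x. w \<bullet> x \<le> s}))"
    if w: "dominates_norm C w" for w s
  proof -
    obtain z1 where z1: "0 \<le> z1" "K \<subseteq> {x. w \<bullet> x \<le> z1}" using coconvex_height[OF K] by blast
    obtain z2 where z2: "0 \<le> z2" "L \<subseteq> {x. w \<bullet> x \<le> z2}" using coconvex_height[OF L] by blast
    define z where "z = max z1 z2"
    \<comment> \<open>The cut lies above both bodies and above the level \<open>s\<close> in
      question; the extra \<open>1\<close> leaves a slab of the cone below the cut, which makes
      \<open>M\<close> positive.\<close>
    define y where "y = max z s + 1"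
    have z: "0 \<le> z" "K \<subseteq> {x. w \<bullet> x \<le> z}" "L \<subseteq> {x. w \<bullet> x \<le> z}"
      using z1 z2 unfolding z_def by auto
    have y: "z < y" "s < y" by (auto simp: y_def)
    let ?H = "{x. w \<bullet> x \<le> y}"
    define A where "A = (C - K) \<inter> ?H"
    define B where "B = (C - L) \<inter> ?H"
    define D where "D = dilate (1 - l) A + dilate l B"
    define M where "M = measure lebesgue (C \<inter> ?H) - measure lebesgue K"
    have mA: "measure lebesgue A = M" and mB: "measure lebesgue B = M"
    proof -
      have "K \<subseteq> ?H" "L \<subseteq> ?H" using z y by force+
      then show "measure lebesgue A = M" "measure lebesgue B = M"
        unfolding A_def B_def M_def using measure_truncated_complement[OF K w, of y]
          measure_truncated_complement[OF L w, of y] V by auto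
    qed
    have A: "convex A" "bounded A" "A \<in> lmeasurable" unfolding A_def using truncation[OF cK _ w] by auto
    have B: "convex B" "bounded B" "B \<in> lmeasurable" unfolding B_def using truncation[OF cL _ w] by auto
    have D_X: "D \<subseteq> X \<inter> ?H"
    proof
      fix d assume "d \<in> D"
      then obtain a b where ab: "a \<in> A" "b \<in> B" and d: "d = (1 - l) *\<^sub>R a + l *\<^sub>R b"
        unfolding D_def set_plus_def by blast
      have "d \<in> X"
        using ab unfolding d X_def by (intro set_plus_intro imageI) (auto simp: A_def B_def)
      moreover have "w \<bullet> d \<le> y"
      proof -
        have "w \<bullet> d = (1 - l) * (w \<bullet> a) + l * (w \<bullet> b)" by (simp add: d inner_add_right)
        also have "\<dots> \<le> (1 - l) * y + l * y"
          using ab l by (intro add_mono mult_left_mono) (auto simp: A_def B_def)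
        finally show ?thesis by (simp add: algebra_simps)
      qed
      ultimately show "d \<in> X \<inter> ?H" by simp
    qed
    have "convex D" unfolding D_def using A B by (intro convex_set_plus convex_scaling)
    moreover have "bounded D"
      unfolding D_def set_plus_image using A B by (intro bounded_plus bounded_scaling)
    ultimately have Dm: "D \<in> lmeasurable" by (rule measurable_convex)
    have M0: "0 < M"
    proof -
      have "measure lebesgue ((C - K) \<inter> {x. w \<bullet> x \<le> y - 1}) < measure lebesgue A"
        unfolding A_def by (rule truncated_complement_strict[OF K w z(1,2)]) (use y in auto)
      then show ?thesis using mA measure_nonneg by (metis order_le_less_trans)
    qed
    have "M powr (1 - l) * M powr l = M" using M0 by (simp add: powr_add[symmetric])
    then have "M \<le> measure lebesgue D"
      using brunn_minkowski_convex(1)[OF A(1,2) B(1,2) l] mA mB by (simp add: D_def)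
    also have D_X_le: "measure lebesgue D \<le> measure lebesgue (X \<inter> ?H)"
      using D_X Dm truncation(3)[OF cX XC w] by (intro measure_mono_fmeasurable) auto
    finally have MX: "M \<le> measure lebesgue (X \<inter> ?H)" .
    have "C - X = C \<inter> ?H - X \<inter> ?H" using NKL z y by force
    then have N: "measure lebesgue (C - X) = measure lebesgue (C \<inter> ?H) - measure lebesgue (X \<inter> ?H)"
      using truncation(3)[OF cX XC w] truncation(3)[OF cone(5) order_refl w] XC
      by (simp, intro measurable_measure_Diff) auto
    have le: "measure lebesgue (C - X) \<le> measure lebesgue K" using MX N by (simp add: M_def)
    moreover have "measure lebesgue ((C - K) \<inter> {x. w \<bullet> x \<le> s}) = measure lebesgue ((C - L) \<inter> {x. w \<bullet> x \<le> s})"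
      if eq: "measure lebesgue (C - X) = measure lebesgue K"
    proof -
      have mD: "measure lebesgue D = M"
        using D_X_le \<open>M \<le> measure lebesgue D\<close> N eq by (simp add: M_def)
      have "w \<noteq> 0"
      proof
        assume "w = 0"
        then show False using interior_slab(2)[OF w, of 0 1] by auto
      qed
      then obtain c where c: "measure lebesgue (A \<inter> {x. w \<bullet> x \<le> s}) = measure lebesgue (B \<inter> {x. w \<bullet> x \<le> s + c})" for s
        using brunn_minkowski_convex(2)[OF A(1,2) B(1,2) l, folded D_def, of w] mA mB mD M0 by auto
      have cut: "A \<inter> {x. w \<bullet> x \<le> t} = (C - K) \<inter> {x. w \<bullet> x \<le> min t y}"
        "B \<inter> {x. w \<bullet> x \<le> t} = (C - L) \<inter> {x. w \<bullet> x \<le> min t y}" for t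
        by (auto simp: A_def B_def)
      have sK: "measure lebesgue (A \<inter> {x. w \<bullet> x \<le> t}) < M" if "t < y" for t
        using truncated_complement_strict[OF K w z(1,2) that y(1)] that mA unfolding cut by (simp add: A_def)
      have sL: "measure lebesgue (B \<inter> {x. w \<bullet> x \<le> t}) < M" if "t < y" for t
        using truncated_complement_strict[OF L w z(1,3) that y(1)] that mB unfolding cut by (simp add: B_def)
      have top: "measure lebesgue (A \<inter> {x. w \<bullet> x \<le> y}) = M" "measure lebesgue (B \<inter> {x. w \<bullet> x \<le> y}) = M"
        using mA mB by (auto simp: A_def B_def Int_assoc)
      \<comment> \<open>Both \<open>A\<close> and \<open>B\<close> reach the full volume
        \<open>M\<close> at level \<open>y\<close> and at no lower level. A nonzero shift would make
        a lower cut of one of them already full.\<close>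
      have "c = 0"
      proof (rule ccontr)
        assume "c \<noteq> 0"
        then consider "0 < c" | "c < 0" by linarith
        then show False
        proof cases
          case 1 then show False using sK[of "y - c"] c[of "y - c"] top by simp
        next
          case 2 then show False using sL[of "y + c"] c[of y] top by simp
        qed
      qed
      then show ?thesis using c[of s] y unfolding cut by (simp add: min_def)
    qed
    ultimately show ?thesis by blast
  qed
  obtain w0 where "dominates_norm C w0" using dominates_norm_exists[OF cone(1,2,4)] .
  then show "measure lebesgue (C - X) \<le> measure lebesgue K" using main by blast
  show "measure lebesgue (C - X) = measure lebesgue K \<Longrightarrow> dominates_norm C w \<Longrightarrow>
      measure lebesgue ((C - K) \<inter> {x. w \<bullet> x \<le> s}) = measure lebesgue ((C - L) \<inter> {x. w \<bullet> x \<le> s})"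
    using main by blast
qed

text \<open>A point \<open>x\<close> of \<open>interior K\<close> outside \<open>L\<close> would be
  detected by a single cut: below a suitable level of some \<open>u\<close>, the complement of
  \<open>K\<close> is empty while that of \<open>L\<close> contains a neighbourhood of
  \<open>x\<close>. The functional is a separating \<open>a\<close>, which lies in the dual cone,
  plus a small multiple of some \<open>w\<close> in its interior.\<close>

lemma interior_subset_of_equal_slabs:
  assumes K: "coconvex_body C K" and L: "coconvex_body C L"
    and eq: "\<And>u s. dominates_norm C u \<Longrightarrow>
      measure lebesgue ((C - K) \<inter> {x. u \<bullet> x \<le> s}) = measure lebesgue ((C - L) \<inter> {x. u \<bullet> x \<le> s})"
  shows "interior K \<subseteq> L"
proof (rule ccontr)
  assume "\<not> interior K \<subseteq> L"
  then obtain x where x: "x \<in> interior K" "x \<notin> L" by blast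
  have cK: "convex (C - K)" and KC: "K \<subset> C" and bK: "bounded K"
    and cL: "convex (C - L)" and clL: "closed L"
    using K L by (auto simp: coconvex_body_def)
  have intKC: "interior K \<subseteq> interior C" using KC by (intro interior_mono) auto
  \<comment> \<open>Separation is carried out at a point pushed outward from \<open>x\<close>. This
    turns weak separation into the gap \<open>a \<bullet> x < a \<bullet> x'\<close>, which later
    absorbs the perturbation.\<close>
  obtain e where e: "0 < e" "(1 + e) *\<^sub>R x \<in> interior K"
  proof -
    obtain d where d: "0 < d" "ball x d \<subseteq> interior K" using x(1) open_contains_ball by blast
    define q where "q = norm x + 1"
    have q: "0 < q" "norm x < q" by (auto simp: q_def add_nonneg_pos)
    define e where "e = d / q"
    have "0 < e" using d q by (simp add: e_def)
    moreover have "norm (e *\<^sub>R x) < d"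
    proof -
      have "norm (e *\<^sub>R x) = e * norm x" using \<open>0 < e\<close> by simp
      also have "\<dots> < e * q" using \<open>0 < e\<close> q by simp
      also have "\<dots> = d" using q by (simp add: e_def)
      finally show ?thesis .
    qed
    then have "(1 + e) *\<^sub>R x \<in> ball x d" by (simp add: dist_norm scaleR_left_distrib)
    ultimately show ?thesis using that d by blast
  qed
  define x' where "x' = (1 + e) *\<^sub>R x"
  have x': "x' \<in> interior K" "x' \<in> interior C" using e(2) intKC by (auto simp: x'_def)
  have "{x'} \<inter> (C - K) = {}" "C - K \<noteq> {}" using x'(1) interior_subset KC by blast+
  then have "\<exists>a b. a \<noteq> 0 \<and> (\<forall>y\<in>{x'}. a \<bullet> y \<le> b) \<and> (\<forall>y\<in>C - K. b \<le> a \<bullet> y)"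
    using cK by (intro separating_hyperplane_sets) auto
  then obtain a b where ab: "a \<noteq> 0" "a \<bullet> x' \<le> b" "\<And>y. y \<in> C - K \<Longrightarrow> b \<le> a \<bullet> y"
    by blast
  then have sep: "a \<bullet> x' \<le> a \<bullet> y" if "y \<in> C - K" for y using that by force
  have aC: "0 \<le> a \<bullet> y" if y: "y \<in> C" for y
  proof (rule ccontr)
    assume n: "\<not> 0 \<le> a \<bullet> y"
    then have y0: "y \<noteq> 0" by auto
    obtain r where r: "\<And>z. z \<in> K \<Longrightarrow> norm z \<le> r" using bK by (auto simp: bounded_iff)
    \<comment> \<open>The first entry carries \<open>t *\<^sub>R y\<close> out of the bounded
      \<open>K\<close>, so that separation applies to it; the second pushes its value under
      \<open>a\<close> below \<open>a \<bullet> x'\<close>.\<close>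
    define t where "t = max ((\<bar>r\<bar> + 1) / norm y) ((\<bar>a \<bullet> x'\<bar> + 1) / (- (a \<bullet> y)))"
    have t: "(\<bar>r\<bar> + 1) / norm y \<le> t" "(\<bar>a \<bullet> x'\<bar> + 1) / (- (a \<bullet> y)) \<le> t" by (auto simp: t_def)
    have "0 < (\<bar>r\<bar> + 1) / norm y" using y0 by (simp add: add_nonneg_pos)
    then have t0: "0 < t" using t(1) by linarith
    have "\<bar>r\<bar> + 1 \<le> t * norm y" using t(1) y0 by (simp add: pos_divide_le_eq)
    then have "t *\<^sub>R y \<notin> K" using r[of "t *\<^sub>R y"] t0 by auto
    then have "a \<bullet> x' \<le> a \<bullet> (t *\<^sub>R y)" using y t0 by (intro sep) (auto intro: cone_scale)
    moreover have "\<bar>a \<bullet> x'\<bar> + 1 \<le> t * (- (a \<bullet> y))" 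
      using t(2) n pos_divide_le_eq[of "- (a \<bullet> y)" "\<bar>a \<bullet> x'\<bar> + 1" t] by linarith
    ultimately show False by simp
  qed
  have ax': "0 < a \<bullet> x'"
  proof -
    obtain d where d: "0 < d" "cball x' d \<subseteq> C"
      using x'(2) mem_interior_cball by blast
    \<comment> \<open>Since \<open>x'\<close> is interior to \<open>C\<close>, a short step against
      \<open>a\<close> stays in \<open>C\<close>, where \<open>a\<close> is nonnegative.\<close>
    have "x' - (d / norm a) *\<^sub>R a \<in> C" using d ab(1) by (intro subsetD[OF d(2)]) (auto simp: dist_norm)
    from aC[OF this] have "(d / norm a) * (a \<bullet> a) \<le> a \<bullet> x'" by (simp add: inner_diff_right)
    moreover have "0 < (d / norm a) * (a \<bullet> a)" using d ab(1) by simp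
    ultimately show ?thesis by linarith
  qed
  have ax: "a \<bullet> x < a \<bullet> x'"
  proof -
    have 1: "a \<bullet> x' = (1 + e) * (a \<bullet> x)" by (simp add: x'_def)
    then have "0 < a \<bullet> x" using ax' e by (simp add: zero_less_mult_iff)
    then show ?thesis using 1 e by (simp add: algebra_simps)
  qed
  obtain w where w: "dominates_norm C w" using dominates_norm_exists[OF cone(1,2,4)] .
  then obtain k where k: "0 < k" "\<And>x. x \<in> C \<Longrightarrow> k * norm x \<le> w \<bullet> x"
    unfolding dominates_norm_def by blast
  define q where "q = \<bar>w \<bullet> x\<bar> + 1"
  have q: "0 < q" "w \<bullet> x \<le> q" by (auto simp: q_def)
  \<comment> \<open>The factor \<open>2 * q\<close> ensures that \<open>h * (w \<bullet> x)\<close>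
    uses up at most half of the gap.\<close>
  define h where "h = (a \<bullet> x' - a \<bullet> x) / (2 * q)"
  have h: "0 < h" using ax q by (simp add: h_def)
  define u where "u = a + h *\<^sub>R w"
  have u: "dominates_norm C u"
    unfolding dominates_norm_def
  proof (intro exI[of _ "h * k"] conjI ballI)
    show "0 < h * k" using h k by simp
    fix y assume y: "y \<in> C"
    have "h * (k * norm y) \<le> h * (w \<bullet> y)" using h k(2)[OF y] by (intro mult_left_mono) auto
    then show "h * k * norm y \<le> u \<bullet> y" using aC[OF y] by (simp add: u_def inner_add_left)
  qed
  have ux: "u \<bullet> x < a \<bullet> x'"
  proof -
    have "h * (w \<bullet> x) \<le> h * q" using h q by (intro mult_left_mono) auto
    also have "\<dots> = (a \<bullet> x' - a \<bullet> x) / 2" using q by (simp add: h_def)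
    also have "\<dots> < a \<bullet> x' - a \<bullet> x" using ax by simp
    finally show ?thesis by (simp add: u_def inner_add_left)
  qed
  define s where "s = (u \<bullet> x + a \<bullet> x') / 2"
  have s: "u \<bullet> x < s" "s < a \<bullet> x'" using ux by (auto simp: s_def)
  have "(C - K) \<inter> {x. u \<bullet> x \<le> s} = {}"
  proof -
    have "s < u \<bullet> y" if y: "y \<in> C - K" for y
    proof -
      have "0 \<le> h * (w \<bullet> y)" using h dominates_norm_nonneg[OF w] y by simp
      then have "a \<bullet> y \<le> u \<bullet> y" by (simp add: u_def inner_add_left)
      then show ?thesis using s sep[OF y] by linarith
    qed
    then show ?thesis by force
  qed
  moreover have "0 < measure lebesgue ((C - L) \<inter> {x. u \<bullet> x \<le> s})"
  proof (rule measure_pos_of_open)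
    show "open (interior C \<inter> - L \<inter> {x. u \<bullet> x < s})"
      using clL open_halfspace_lt[of u s] by (intro open_Int open_interior) auto
    show "interior C \<inter> - L \<inter> {x. u \<bullet> x < s} \<noteq> {}" using x intKC s by blast
    show "interior C \<inter> - L \<inter> {x. u \<bullet> x < s} \<subseteq> (C - L) \<inter> {x. u \<bullet> x \<le> s}"
      using interior_subset by auto
    show "(C - L) \<inter> {x. u \<bullet> x \<le> s} \<in> lmeasurable" by (rule truncation(3)[OF cL _ u]) auto
  qed
  ultimately show False using eq[OF u, of s] by simp
qed

lemma coconvex_eq_of_equal_slabs:
  assumes "coconvex_body C K" "coconvex_body C L" "regular_closed K" "regular_closed L"
    and "\<And>u s. dominates_norm C u \<Longrightarrow>
      measure lebesgue ((C - K) \<inter> {x. u \<bullet> x \<le> s}) = measure lebesgue ((C - L) \<inter> {x. u \<bullet> x \<le> s})"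
  shows "K = L"
proof
  have "closed K" "closed L" using assms by (auto simp: coconvex_body_def)
  then have "closure (interior K) \<subseteq> L" "closure (interior L) \<subseteq> K"
    using interior_subset_of_equal_slabs[OF assms(1,2)] interior_subset_of_equal_slabs[OF assms(2,1)] assms(5)
    by (simp_all add: closure_minimal)
  then show "K \<subseteq> L" "L \<subseteq> K" using assms(3,4) by (auto simp: regular_closed_def)
qed

section \<open>Dilates inside the cone, and bodies of volume zero\<close>

lemma dilate_cone: "0 < t \<Longrightarrow> dilate t C = C"
proof -
  assume t: "0 < t"
  have "x \<in> dilate t C" if "x \<in> C" for x
    using t cone_scale[OF that, of "1 / t"] by (intro image_eqI[of _ _ "(1 / t) *\<^sub>R x"]) auto
  then show ?thesis using cone_scale t by auto
qed

lemma dilate_complement: "0 < t \<Longrightarrow> C - dilate t K = dilate t (C - K)"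
  using dilate_cone[of t] by (subst image_set_diff) (auto simp: inj_on_def)

lemma coconvex_body_dilate:
  assumes "0 < t" "coconvex_body C K"
  shows "coconvex_body C (dilate t K)"
  unfolding coconvex_body_def
proof (intro conjI)
  show "dilate t K \<noteq> {}" "closed (dilate t K)" "bounded (dilate t K)"
    using assms by (auto simp: coconvex_body_def intro: closed_scaling bounded_scaling)
  show "convex (C - dilate t K)"
    unfolding dilate_complement[OF assms(1)] using assms(2)
    by (intro convex_scaling) (simp add: coconvex_body_def)
  have "C - dilate t K \<noteq> {}"
    unfolding dilate_complement[OF assms(1)] using assms(2) by (auto simp: coconvex_body_def)
  moreover have "dilate t K \<subseteq> C"
    using assms(2) image_mono[of K C "(*\<^sub>R) t"] dilate_cone[OF assms(1)] by (auto simp: coconvex_body_def)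
  ultimately show "dilate t K \<subset> C" by blast
qed

text \<open>A null body contains no open piece of the cone, so \<open>C - K\<close> has points
  arbitrarily close to the apex. Subtracting such a point from an interior point of
  \<open>C - L\<close> does not leave \<open>C - L\<close>; hence the sum covers that interior, and
  what it misses exceeds \<open>L\<close> only by a null frontier.\<close>

lemma measure_coconvex_sum_null:
  assumes K: "coconvex_body C K" "measure lebesgue K = 0" and L: "coconvex_body C L"
  shows "measure lebesgue (coconvex_sum C K L) \<le> measure lebesgue L"
proof -
  let ?X = "(C - K) + (C - L)"
  have cK: "convex (C - K)" and cL: "convex (C - L)" using K L by (auto simp: coconvex_body_def)
  have "interior (C - L) \<subseteq> ?X"
  proof
    fix y assume "y \<in> interior (C - L)"
    then obtain d where d: "0 < d" "ball y d \<subseteq> C - L" using mem_interior by blast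
    obtain w where w: "dominates_norm C w" using dominates_norm_exists[OF cone(1,2,4)] .
    then obtain k where k: "0 < k" "\<And>x. x \<in> C \<Longrightarrow> k * norm x \<le> w \<bullet> x"
      unfolding dominates_norm_def by blast
    \<comment> \<open>Because \<open>k * norm c \<le> w \<bullet> c\<close> on \<open>C\<close>, the
      level \<open>k * d\<close> forces \<open>norm c < d\<close>.\<close>
    let ?U = "interior C \<inter> {x. 0 < w \<bullet> x} \<inter> {x. w \<bullet> x < k * d}"
    have "open ?U" "?U \<noteq> {}" using interior_slab[OF w, of 0 "k * d"] k d by auto
    then have "\<not> ?U \<subseteq> K" 
      using measure_pos_of_open[of ?U K] coconvex_lmeasurable[OF K(1)] K(2) by auto
    then obtain c where c: "c \<in> C - K" "w \<bullet> c < k * d" using interior_subset by blast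
    have "k * norm c < k * d" using k(2)[of c] c by auto
    then have "y - c \<in> ball y d" using k by (simp add: dist_norm)
    then have "y - c \<in> C - L" using d(2) by blast
    then have "c + (y - c) \<in> ?X" using c(1) by (intro set_plus_intro)
    then show "y \<in> ?X" by simp
  qed
  then have "coconvex_sum C K L \<subseteq> L \<union> frontier (C - L)"
    using closure_subset[of "C - L"] by (auto simp: coconvex_sum_def frontier_def)
  moreover have neg: "negligible (frontier (C - L))" using cL by (rule negligible_convex_frontier)
  moreover have "coconvex_sum C K L \<in> sets lebesgue"
    unfolding coconvex_sum_def using cone(5) cK cL
    by (intro sets.Diff sets_lebesgue_convex convex_set_plus)
  ultimately have "measure lebesgue (coconvex_sum C K L) \<le> measure lebesgue (L \<union> frontier (C - L))"
    using coconvex_lmeasurable[OF L] negligible_imp_measurable[OF neg]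
    by (intro measure_mono_fmeasurable fmeasurable.Un) auto
  also have "\<dots> \<le> measure lebesgue L + measure lebesgue (frontier (C - L))"
    using coconvex_lmeasurable[OF L] negligible_imp_measurable[OF neg]
    by (intro measure_Un_le) auto
  also have "\<dots> = measure lebesgue L" using negligible_imp_measure0[OF neg] by simp
  finally show ?thesis .
qed

end

section \<open>Algebra of dilates, and reduction to unit volume\<close>

lemma dilate_set_plus: "dilate t (X + Y) = dilate t X + dilate t (Y :: 'a::real_vector set)"
proof
  show "dilate t (X + Y) \<subseteq> dilate t X + dilate t Y"
  proof
    fix z assume "z \<in> dilate t (X + Y)"
    then obtain x y where "x \<in> X" "y \<in> Y" "z = t *\<^sub>R (x + y)" unfolding set_plus_def by blast
    then show "z \<in> dilate t X + dilate t Y" by (auto simp: scaleR_add_right)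
  qed
  show "dilate t X + dilate t Y \<subseteq> dilate t (X + Y)"
  proof
    fix z assume "z \<in> dilate t X + dilate t Y"
    then obtain x y where xy: "x \<in> X" "y \<in> Y" "z = t *\<^sub>R x + t *\<^sub>R y" unfolding set_plus_def by blast
    then have "z = t *\<^sub>R (x + y)" by (simp add: scaleR_add_right)
    then show "z \<in> dilate t (X + Y)"
      using imageI[OF set_plus_intro[OF xy(1,2)], of "(*\<^sub>R) t"] by simp
  qed
qed

lemma dilate_add_convex:
  fixes X :: "'a::real_vector set"
  assumes "convex X" "0 < a" "0 < b"
  shows "dilate a X + dilate b X = dilate (a + b) X"
proof
  show "dilate (a + b) X \<subseteq> dilate a X + dilate b X"
  proof
    fix z assume "z \<in> dilate (a + b) X"
    then obtain x where "x \<in> X" "z = (a + b) *\<^sub>R x" by blast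
    then show "z \<in> dilate a X + dilate b X" by (auto simp: scaleR_add_left)
  qed
  show "dilate a X + dilate b X \<subseteq> dilate (a + b) X"
  proof
    fix z assume "z \<in> dilate a X + dilate b X"
    then obtain x y where xy: "x \<in> X" "y \<in> X" "z = a *\<^sub>R x + b *\<^sub>R y" unfolding set_plus_def by blast
    have "(a / (a + b)) *\<^sub>R x + (b / (a + b)) *\<^sub>R y \<in> X"
      using assms xy by (intro convexD[OF assms(1)]) (auto simp: add_divide_distrib[symmetric])
    moreover have "z = (a + b) *\<^sub>R ((a / (a + b)) *\<^sub>R x + (b / (a + b)) *\<^sub>R y)"
      using assms xy(3) by (simp add: scaleR_add_right)
    ultimately show "z \<in> dilate (a + b) X" by blast
  qed
qed

lemma measure_dilate:
  fixes K :: "'a::euclidean_space set"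
  shows "0 \<le> t \<Longrightarrow> measure lebesgue (dilate t K) = t ^ DIM('a) * measure lebesgue K"
  using measure_lebesgue_affine[of t 0 K] by simp

lemma dilate_dilate: "dilate s (dilate t K) = dilate (s * t) (K :: 'a::real_vector set)"
  by (simp add: image_image)

lemma regular_closed_dilate:
  fixes K :: "'a::euclidean_space set"
  assumes "t \<noteq> 0" "regular_closed K"
  shows "regular_closed (dilate t K)"
  using assms by (simp add: regular_closed_def interior_dilate closure_scaleR[symmetric])

lemma regular_closed_measure_pos:
  fixes K :: "'a::euclidean_space set"
  assumes "regular_closed K" "K \<noteq> {}" "K \<in> lmeasurable"
  shows "0 < measure lebesgue K"
proof -
  have "interior K \<noteq> {}" using assms(1,2) by (auto simp: regular_closed_def)
  then show ?thesis using assms(3) interior_subset by (intro measure_pos_of_open[of "interior K"]) auto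
qed

theorem theorem1:
  fixes C K1 K2 :: "(real ^ 'n::finite) set" and l :: real
  defines "lhs \<equiv> root CARD('n)
             (measure lebesgue (coconvex_sum C (dilate (1 - l) K1) (dilate l K2)))"
    and "rhs \<equiv> (1 - l) * root CARD('n) (measure lebesgue K1)
              + l * root CARD('n) (measure lebesgue K2)"
  assumes "pointed_solid_cone C"
    and "coconvex_body C K1" and "coconvex_body C K2"
    and "0 < l" and "l < 1"
  shows "lhs \<le> rhs
    \<and> ((\<exists>\<alpha>>0. K1 = dilate \<alpha> K2) \<longrightarrow> lhs = rhs)
    \<and> (regular_closed K1 \<and> regular_closed K2 \<longrightarrow>
         (lhs = rhs \<longleftrightarrow> (\<exists>\<alpha>>0. K1 = dilate \<alpha> K2)))"
proof -
  interpret solid_cone C by unfold_locales (rule assms(3))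
  note K1 = assms(4) and K2 = assms(5) and l = assms(6,7)
  let ?n = "CARD('n)"
  define S where "S = coconvex_sum C (dilate (1 - l) K1) (dilate l K2)"
  have root_dilate: "root ?n (measure lebesgue (dilate t X)) = t * root ?n (measure lebesgue X)"
    if "0 \<le> t" for t and X :: "(real ^ 'n) set"
    using that by (simp add: measure_dilate real_root_mult real_root_power_cancel)
  have S: "S = C - (dilate (1 - l) (C - K1) + dilate l (C - K2))"
    unfolding S_def coconvex_sum_def using l by (simp add: dilate_complement)
  have conv: "convex (C - K2)" using K2 by (simp add: coconvex_body_def)
  \<comment> \<open>The two complements are dilates of one convex set, so their combination is again
    a dilate of it and the coconvex sum is \<open>K2\<close> scaled by
    \<open>(1 - l) * a + l\<close>.\<close>
  have homothetic: "lhs = rhs" if a: "0 < a" and eq: "K1 = dilate a K2" for a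
  proof -
    have "dilate (1 - l) (C - K1) + dilate l (C - K2) = dilate ((1 - l) * a) (C - K2) + dilate l (C - K2)"
      by (simp only: eq dilate_complement[OF a] dilate_dilate)
    also have "\<dots> = dilate ((1 - l) * a + l) (C - K2)"
      using a l by (intro dilate_add_convex[OF conv]) auto
    finally have "S = C - dilate ((1 - l) * a + l) (C - K2)" unfolding S by simp
    also have "\<dots> = dilate ((1 - l) * a + l) (C - (C - K2))"
      using a l by (intro dilate_complement) (auto intro: add_pos_pos)
    also have "C - (C - K2) = K2" using K2 by (auto simp: coconvex_body_def)
    finally have "lhs = ((1 - l) * a + l) * root ?n (measure lebesgue K2)"
      unfolding lhs_def S_def[symmetric] using a l by (simp add: root_dilate)
    also have "\<dots> = rhs" unfolding rhs_def eq using a by (simp add: root_dilate algebra_simps)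
    finally show ?thesis .
  qed
  have main: "lhs \<le> rhs \<and> (regular_closed K1 \<and> regular_closed K2 \<and> lhs = rhs \<longrightarrow> (\<exists>a>0. K1 = dilate a K2))"
  proof (cases "measure lebesgue K1 = 0 \<or> measure lebesgue K2 = 0")
    case True
    have d: "coconvex_body C (dilate (1 - l) K1)" "coconvex_body C (dilate l K2)"
      using K1 K2 l by (auto intro: coconvex_body_dilate)
    have "lhs \<le> rhs"
    proof (cases "measure lebesgue K1 = 0")
      case True
      then have "measure lebesgue S \<le> measure lebesgue (dilate l K2)"
        unfolding S_def using l d by (intro measure_coconvex_sum_null) (auto simp: measure_dilate)
      then have "lhs \<le> root ?n (measure lebesgue (dilate l K2))" unfolding lhs_def S_def by simp
      then show ?thesis using True l by (simp add: rhs_def root_dilate)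
    next
      case False
      then have z: "measure lebesgue K2 = 0" using True by simp
      have "measure lebesgue S \<le> measure lebesgue (dilate (1 - l) K1)"
        unfolding S_def coconvex_sum_def add.commute[of "C - dilate (1 - l) K1"]
        unfolding coconvex_sum_def[symmetric]
        using l d z by (intro measure_coconvex_sum_null) (auto simp: measure_dilate)
      then have "lhs \<le> root ?n (measure lebesgue (dilate (1 - l) K1))" unfolding lhs_def S_def by simp
      then show ?thesis using z l by (simp add: rhs_def root_dilate)
    qed
    \<comment> \<open>A nonempty regular closed body has positive volume, so the equality claim is
      vacuous here.\<close>
    moreover have "\<not> (regular_closed K1 \<and> regular_closed K2)"
      using True regular_closed_measure_pos coconvex_lmeasurable K1 K2
      by (metis coconvex_body_def less_irrefl)
    ultimately show ?thesis by blast
  next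
    case False
    define r1 where "r1 = root ?n (measure lebesgue K1)"
    define r2 where "r2 = root ?n (measure lebesgue K2)"
    have r: "0 < r1" "0 < r2" using False by (auto simp: r1_def r2_def zero_less_measure_iff)
    define N1 where "N1 = dilate (1 / r1) K1"
    define N2 where "N2 = dilate (1 / r2) K2"
    have K1_N1: "K1 = dilate r1 N1" and K2_N2: "K2 = dilate r2 N2"
      unfolding N1_def N2_def dilate_dilate using r by auto
    have N: "coconvex_body C N1" "coconvex_body C N2"
      unfolding N1_def N2_def using r K1 K2 by (auto intro!: coconvex_body_dilate)
    have "measure lebesgue K1 = r1 ^ ?n" "measure lebesgue K2 = r2 ^ ?n"
      by (auto simp: r1_def r2_def)
    then have mN: "measure lebesgue N1 = 1" "measure lebesgue N2 = 1"
      unfolding N1_def N2_def using r by (auto simp: measure_dilate power_one_over)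
    have rhs: "rhs = (1 - l) * r1 + l * r2" by (simp add: rhs_def r1_def r2_def)
    have rhs0: "0 < rhs" unfolding rhs using r l by (auto intro: add_pos_pos)
    \<comment> \<open>After rescaling to unit volume the weights become \<open>(1 - l) * r1\<close>
      and \<open>l * r2\<close>, whose sum is \<open>rhs\<close>; \<open>m\<close> is the share of
      the second. The coconvex sum is then \<open>rhs\<close> times the combination of
      \<open>N1\<close> and \<open>N2\<close> with weight \<open>m\<close>.\<close>
    define m where "m = l * r2 / rhs"
    have m: "0 < m" "m < 1" "rhs * m = l * r2" "rhs * (1 - m) = (1 - l) * r1"
      using r l rhs0 unfolding m_def by (auto simp: rhs field_simps)
    define X where "X = dilate (1 - m) (C - N1) + dilate m (C - N2)"
    have "dilate (1 - l) (C - K1) + dilate l (C - K2) = dilate rhs X"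
      unfolding X_def dilate_set_plus dilate_dilate m K1_N1 K2_N2
      by (simp add: dilate_complement[OF r(1)] dilate_complement[OF r(2)] dilate_dilate)
    then have "S = dilate rhs (C - X)" unfolding S using dilate_complement[OF rhs0] by simp
    then have lhs: "lhs = rhs * root ?n (measure lebesgue (C - X))"
      unfolding lhs_def S_def[symmetric] using rhs0 by (simp add: root_dilate)
    note comb = coconvex_combination[OF N m(1,2), folded X_def]
    have "measure lebesgue (C - X) \<le> 1" using comb(1) mN by simp
    then have "lhs \<le> rhs" unfolding lhs using rhs0 by simp
    moreover have "\<exists>a>0. K1 = dilate a K2"
      if reg: "regular_closed K1" "regular_closed K2" and eq: "lhs = rhs"
    proof -
      have "measure lebesgue (C - X) = 1" using eq rhs0 unfolding lhs by simp
      then have "N1 = N2"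
        using comb(2) mN N reg r
        by (intro coconvex_eq_of_equal_slabs) (auto simp: N1_def N2_def intro!: regular_closed_dilate)
      then have "K1 = dilate (r1 / r2) K2"
        using r unfolding K1_N1 K2_N2 dilate_dilate by simp
      then show ?thesis using r by (intro exI[of _ "r1 / r2"]) auto
    qed
    ultimately show ?thesis by blast
  qed
  show ?thesis using main homothetic by blast
qed

end
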